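(* Consider the problem and the distributed gradient tracking algorithm with true gradients described in the context, in the time-invariant case $f_{i,t}=f_i$ for all $t\ge 0$, $i\in[N]$, so that $f_t=f$ for all $t\ge0$ with $f(x)=\sum_{i=1}^N f_i(x_i,\nu(x))$. Assume: (1) each $X_i\subseteq\mathbb{R}^{n_i}$ is nonempty, convex and compact, and there is $B>0$ with $\|x_i\|\le B$ for all $x_i\in X_i$, $i\in[N]$; (2) $f:\mathbb{R}^n\to\mathbb{R}$ is convex; (3) there is $L_1$ such that $\|\nabla_1 f(x,y)-\nabla_1 f(x',y')\|\le L_1(\|x-x'\|+\|y-y'\|)$ and $\|\nabla_2 f(x,y)-\nabla_2 f(x',y')\|\le L_1(\|x-x'\|+\|y-y'\|)$ for all $x,x'\in X$, $y,y'\in\mathbb{R}^{Nd}$; (4) there is $G>0$ such that $\|\nabla_1 f(x,y)\|\le G$, $\|\nabla_2 f(x,y)\|\le G$, $\|\nabla\psi_i(x_i)\|\le G$ for all $x\in X$, $y\in\mathbb{R}^{Nd}$, $i\in[N]$; (5) there is $L_2$ such that $\|\nabla\psi_i(x)-\nabla\psi_i(x')\|\le L_2\|x-x'\|$ for all $x,x'\in X_i$, $i\in[N]$; (6) there is an integer $Q>0$ such that the union graph $(\mathcal{V},\bigcup_{l=0}^{Q-1}\mathcal{E}_{k+l})$ is strongly connected for every $k\ge 0$; (7) $A_t=(a_{ij,t})$ is doubly stochastic for every $t\ge 0$; (8) there is $a\in(0,1)$ such that, for all $t\ge0$, $a_{ij,t}\ge a$ whenever $a_{ij,t}>0$, and $a_{ii,t}\ge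 a$ for all $i\in[N]$. Let $\alpha_0=1$ and $\alpha_t=1/\sqrt{t}$ for $t\ge 1$. Then $$f(\bar{x}_T)-f(x^* )=O\Big(\frac{1}{\sqrt{T}}\Big),\qquad \bar{x}_T:=\frac1T\sum_{t=1}^T x_t,\quad x^*\in\arg\min_{x\in X}f(x).$$
   Context: Notation: $[N]=\{1,\dots,N\}$; $col(z_1,\dots,z_k)$ stacks column vectors; $\|\cdot\|$ is the Euclidean norm (for matrices, the induced norm); $P_S$ is Euclidean projection onto a closed convex set $S$. Problem. There are $N$ agents; $n=\sum_{i=1}^N n_i$; $X_i\subseteq\mathbb{R}^{n_i}$, $X=\prod_{i=1}^N X_i$; $\psi_i:\mathbb{R}^{n_i}\to\mathbb{R}^d$ is differentiable. For $x=col(x_1,\dots,x_N)$ the aggregative variable is $\nu(x)=\frac1N\sum_{i=1}^N\psi_i(x_i)$. The local losses $f_i:\mathbb{R}^{n_i}\times\mathbb{R}^d\to\mathbb{R}$ are differentiable. $\nabla_1 f_i$ and $\nabla_2 f_i$ are the gradients in the first and second argument. For a vector-valued $g=col(g_1,\dots,g_m)$, $\nabla g=(\nabla g_1,\dots,\nabla g_m)$ (transposed Jacobian), so $\nabla\psi_i(x_i)\in\mathbb{R}^{n_i\times d}$. For $x\in\mathbb{R}^n$, $y=col(y_1,\dots,y_N)\in\mathbb{R}^{Nd}$ and $k=1,2$: $\nabla_k f(x,y)=col(\nabla_k f_1(x_1,y_1),\dots,\nabla_k f_N(x_N,y_N))$. Network. For each $t\ge0$, $\mathcal{G}_t=(\mathcal{V},\mathcal{E}_t)$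 is a directed graph on $\mathcal{V}=[N]$ with matrix $A_t=(a_{ij,t})\in\mathbb{R}^{N\times N}$ with nonnegative entries; for $i\ne j$, $a_{ij,t}>0$ if $(j,i)\in\mathcal{E}_t$ and $a_{ij,t}=0$ otherwise. Algorithm (DGT with true gradients), stepsizes $\alpha_t>0$. Initialize $x_{i,0}\in X_i$ arbitrarily, $\nu_{i,0}=\psi_i(x_{i,0})$, $y_{i,0}=\nabla_2 f_i(x_{i,0},\nu_{i,0})$. For $t\ge 0$ and each $i\in[N]$: $x_{i,t+1}=P_{X_i}[x_{i,t}-\alpha_t(\nabla_1 f_i(x_{i,t},\nu_{i,t})+\nabla\psi_i(x_{i,t})y_{i,t})]$, $\nu_{i,t+1}=\sum_{j=1}^N a_{ij,t}\nu_{j,t}+\psi_i(x_{i,t+1})-\psi_i(x_{i,t})$, $y_{i,t+1}=\sum_{j=1}^N a_{ij,t}y_{j,t}+\nabla_2 f_i(x_{i,t+1},\nu_{i,t+1})-\nabla_2 f_i(x_{i,t},\nu_{i,t})$. Write $x_t=col(x_{1,t},\dots,x_{N,t})$. $O(\cdot)$ is with respect to $T\ge1$: the implied constant does not depend on $T$. *)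

theory Defs
  imports "HOL-Analysis.Analysis" "Graph_Theory.Pair_Digraph" "Graph_Theory.Digraph_Component"
begin

text \<open>
  The agents are the elements of a finite type \<^typ>\<open>'a\<close>, so \<open>N = CARD('a)\<close>. The
  dimensions \<open>n\<^sub>i\<close> of the agents' decision spaces may all be different; they are encoded by
  a map \<open>own\<close> that sends each of the \<open>n = CARD('n)\<close> coordinates of the stacked vector
  \<open>x = col(x\<^sub>1,\<dots>,x\<^sub>N)\<close> to the agent owning it, so that \<open>n\<^sub>i\<close> is the number of
  coordinates owned by \<open>i\<close> and \<open>n\<close> is the sum of the \<open>n\<^sub>i\<close>.
  The decision space of agent \<open>i\<close>, of dimension \<open>n\<^sub>i\<close>, is identified isometrically with the
  coordinate subspace \<open>block_space own i\<close>, and a function on it with a function on the whole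
  space that depends on the coordinates of \<open>i\<close> only (see \<open>depends_on_block\<close>). The gradient of such a function has
  all its entries outside the block of \<open>i\<close> equal to zero, so it is the gradient taken in the
  block.
\<close>

definition block :: "('n \<Rightarrow> 'a) \<Rightarrow> 'a \<Rightarrow> real ^ 'n \<Rightarrow> real ^ 'n" where
  "block own i x = (\<chi> k. if own k = i then x $ k else 0)"

definition block_space :: "('n \<Rightarrow> 'a) \<Rightarrow> 'a \<Rightarrow> (real ^ 'n) set" where
  "block_space own i = {x. \<forall>k. own k \<noteq> i \<longrightarrow> x $ k = 0}"

definition depends_on_block :: "('n \<Rightarrow> 'a) \<Rightarrow> 'a \<Rightarrow> (real ^ 'n \<Rightarrow> 'b) \<Rightarrow> bool" where
  "depends_on_block own i g \<longleftrightarrow> (\<forall>x. g (block own i x) = g x)"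

definition block_product :: "('n \<Rightarrow> 'a) \<Rightarrow> ('a \<Rightarrow> (real ^ 'n) set) \<Rightarrow> (real ^ 'n) set" where
  "block_product own X = {x. \<forall>i. block own i x \<in> X i}"

definition gradient :: "('b::real_inner \<Rightarrow> real) \<Rightarrow> 'b \<Rightarrow> 'b" where
  "gradient g x = (THE D. GDERIV g x :> D)"

definition gradient1 :: "('b::real_inner \<times> 'c \<Rightarrow> real) \<Rightarrow> 'b \<Rightarrow> 'c \<Rightarrow> 'b" where
  "gradient1 g x y = gradient (\<lambda>u. g (u, y)) x"

definition gradient2 :: "('b \<times> 'c::real_inner \<Rightarrow> real) \<Rightarrow> 'b \<Rightarrow> 'c \<Rightarrow> 'c" where
  "gradient2 g x y = gradient (\<lambda>v. g (x, v)) y"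

definition vec_gradient :: "(real ^ 'n \<Rightarrow> real ^ 'd) \<Rightarrow> real ^ 'n \<Rightarrow> real ^ 'd ^ 'n" where
  "vec_gradient g x = transpose (jacobian g (at x))"

definition aggregate ::
  "('n \<Rightarrow> 'a::finite) \<Rightarrow> ('a \<Rightarrow> real ^ 'n \<Rightarrow> real ^ 'd) \<Rightarrow> real ^ 'n \<Rightarrow> real ^ 'd" where
  "aggregate own \<psi> x = (1 / real CARD('a)) *\<^sub>R (\<Sum>i\<in>UNIV. \<psi> i (block own i x))"

definition total_loss ::
  "('n \<Rightarrow> 'a::finite) \<Rightarrow> ('a \<Rightarrow> real ^ 'n \<Rightarrow> real ^ 'd) \<Rightarrow>
   ('a \<Rightarrow> (real ^ 'n) \<times> (real ^ 'd) \<Rightarrow> real) \<Rightarrow> real ^ 'n \<Rightarrow> real" where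
  "total_loss own \<psi> f x = (\<Sum>i\<in>UNIV. f i (block own i x, aggregate own \<psi> x))"

text \<open>Vectors \<open>y = col(y\<^sub>1,\<dots>,y\<^sub>N)\<close> with \<open>y\<^sub>i\<close> in \<^typ>\<open>real ^ 'd\<close> have type
  \<^typ>\<open>real ^ 'd ^ 'a\<close>, whose norm is the Euclidean norm of the stacked vector.\<close>

definition stacked_gradient1 ::
  "('n \<Rightarrow> 'a) \<Rightarrow> ('a \<Rightarrow> (real ^ 'n) \<times> (real ^ 'd) \<Rightarrow> real) \<Rightarrow>
   real ^ 'n \<Rightarrow> real ^ 'd ^ 'a \<Rightarrow> real ^ 'n" where
  "stacked_gradient1 own f x y =
     (\<chi> k. gradient1 (f (own k)) (block own (own k) x) (y $ own k) $ k)"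

definition stacked_gradient2 ::
  "('n \<Rightarrow> 'a) \<Rightarrow> ('a \<Rightarrow> (real ^ 'n) \<times> (real ^ 'd) \<Rightarrow> real) \<Rightarrow>
   real ^ 'n \<Rightarrow> real ^ 'd ^ 'a \<Rightarrow> real ^ 'd ^ 'a" where
  "stacked_gradient2 own f x y = (\<chi> i. gradient2 (f i) (block own i x) (y $ i))"

text \<open>The entry \<open>W $ i $ j\<close> is the weight that agent \<open>i\<close> gives to agent \<open>j\<close>; it belongs to
  the edge from \<open>j\<close> to \<open>i\<close>. Diagonal weights are not tied to the edges.\<close>

definition weight_matrix :: "('a \<times> 'a) set \<Rightarrow> real ^ 'a ^ 'a \<Rightarrow> bool" where
  "weight_matrix E W \<longleftrightarrow>
     (\<forall>i j. 0 \<le> W $ i $ j) \<and>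
     (\<forall>i j. i \<noteq> j \<longrightarrow> (if (j, i) \<in> E then 0 < W $ i $ j else W $ i $ j = 0))"

definition doubly_stochastic :: "real ^ 'a ^ 'a::finite \<Rightarrow> bool" where
  "doubly_stochastic W \<longleftrightarrow>
     (\<forall>i j. 0 \<le> W $ i $ j) \<and> (\<forall>i. (\<Sum>j\<in>UNIV. W $ i $ j) = 1) \<and>
     (\<forall>j. (\<Sum>i\<in>UNIV. W $ i $ j) = 1)"

text \<open>The sequences \<open>x\<close>, \<open>\<nu>\<close>, \<open>y\<close> are generated by distributed gradient tracking with stepsizes
  \<open>\<alpha>\<close>. The blocks of \<open>x t\<close> are the agents' decisions at time \<open>t\<close>.\<close>

definition DGT ::
  "('n \<Rightarrow> 'a::finite) \<Rightarrow> ('a \<Rightarrow> (real ^ 'n) set) \<Rightarrow> ('a \<Rightarrow> real ^ 'n \<Rightarrow> real ^ 'd) \<Rightarrow>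
   ('a \<Rightarrow> (real ^ 'n) \<times> (real ^ 'd) \<Rightarrow> real) \<Rightarrow> (nat \<Rightarrow> real ^ 'a ^ 'a) \<Rightarrow> (nat \<Rightarrow> real) \<Rightarrow>
   (nat \<Rightarrow> real ^ 'n) \<Rightarrow> (nat \<Rightarrow> real ^ 'd ^ 'a) \<Rightarrow> (nat \<Rightarrow> real ^ 'd ^ 'a) \<Rightarrow> bool" where
  "DGT own X \<psi> f A \<alpha> x \<nu> y \<longleftrightarrow>
     (\<forall>i. block own i (x 0) \<in> X i \<and>
          \<nu> 0 $ i = \<psi> i (block own i (x 0)) \<and>
          y 0 $ i = gradient2 (f i) (block own i (x 0)) (\<nu> 0 $ i)) \<and>
     (\<forall>t i.
        block own i (x (Suc t)) =
          closest_point (X i)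
            (block own i (x t) - \<alpha> t *\<^sub>R
               (gradient1 (f i) (block own i (x t)) (\<nu> t $ i) +
                vec_gradient (\<psi> i) (block own i (x t)) *v (y t $ i))) \<and>
        \<nu> (Suc t) $ i =
          (\<Sum>j\<in>UNIV. (A t $ i $ j) *\<^sub>R (\<nu> t $ j)) +
          \<psi> i (block own i (x (Suc t))) - \<psi> i (block own i (x t)) \<and>
        y (Suc t) $ i =
          (\<Sum>j\<in>UNIV. (A t $ i $ j) *\<^sub>R (y t $ j)) +
          gradient2 (f i) (block own i (x (Suc t))) (\<nu> (Suc t) $ i) -
          gradient2 (f i) (block own i (x t)) (\<nu> t $ i))"

end

theory Submission
  imports Defs
begin

text \<open>
  Call the diameter of the rows of a stacked vector its spread. Since the union graphs are strongly
  connected and all positive weights and all diagonal weights are at least \<open>a\<close>, every product of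
  \<open>M = N Q\<close> consecutive weight matrices has all entries at least \<open>a ^ M\<close>, so it shrinks the spread by
  the factor \<open>1 - a ^ M\<close>. Double stochasticity preserves the mean, so \<open>\<nu> t\<close> has mean \<open>\<nu>(x\<^sub>t)\<close> and
  \<open>y t\<close> has mean equal to the average of the local gradients \<open>\<nabla>\<^sub>2 f\<^sub>i\<close>. As the spread contracts and
  the gradients are bounded, \<open>y\<close> is bounded; therefore \<open>x\<^sub>t\<close> moves by \<open>O(\<alpha>\<^sub>t)\<close>, and both recursions are
  contractions perturbed by \<open>O(\<alpha>\<^sub>t)\<close>. Summing them over \<open>t < T\<close> bounds the total spread of \<open>\<nu>\<close> and of
  \<open>y\<close> by \<open>O(\<Sum>\<^sub>t \<alpha>\<^sub>t) = O(\<surd>T)\<close>, without any convolution estimate. The direction used by the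
  algorithm thus differs from the gradient of the total loss by an error with partial sums
  \<open>O(\<surd>T)\<close>, and the usual analysis of projected subgradient steps with Jensen's inequality gives
  the rate.
\<close>

section \<open>Consensus over a time-varying network\<close>

definition mean :: "'v::real_normed_vector ^ 'a::finite \<Rightarrow> 'v" where
  "mean w = (1 / real CARD('a)) *\<^sub>R (\<Sum>i\<in>UNIV. w $ i)"

definition spread :: "'v::real_normed_vector ^ 'a::finite \<Rightarrow> real" where
  "spread w = diameter (range (($) w))"

definition mix :: "real ^ 'a ^ 'a \<Rightarrow> 'v::real_normed_vector ^ 'a \<Rightarrow> 'v ^ 'a::finite" where
  "mix W w = (\<chi> i. \<Sum>j\<in>UNIV. W $ i $ j *\<^sub>R w $ j)"

fun transition :: "(nat \<Rightarrow> real ^ 'a ^ 'a) \<Rightarrow> nat \<Rightarrow> nat \<Rightarrow> real ^ 'a ^ 'a::finite" where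
  "transition A k 0 = mat 1"
| "transition A k (Suc m) = A (k + m) ** transition A k m"

section \<open>Elementary bounds for the spread and the mean\<close>

lemma spread_ge: "norm (w $ i - w $ j) \<le> spread w"
proof -
  have "bounded (range (($) w))"
    by (simp add: finite_imp_bounded)
  then show ?thesis
    unfolding spread_def dist_norm[symmetric] by (rule diameter_bounded_bound) auto
qed

lemma spread_le:
  assumes "\<And>i j. norm (w $ i - w $ j) \<le> d"
  shows "spread w \<le> d"
  unfolding spread_def using assms by (intro diameter_le) auto

lemma spread_nonneg: "0 \<le> spread w"
  using norm_ge_zero spread_ge by (rule order_trans)

lemma spread_add: "spread (u + w) \<le> spread u + spread w"
proof (rule spread_le)
  fix i j
  have "(u + w) $ i - (u + w) $ j = (u $ i - u $ j) + (w $ i - w $ j)"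
    by simp
  then show "norm ((u + w) $ i - (u + w) $ j) \<le> spread u + spread w"
    using norm_triangle_mono[OF spread_ge spread_ge] by metis
qed

lemma spread_le_norm: "spread w \<le> 2 * norm w"
proof (rule spread_le)
  fix i j
  show "norm (w $ i - w $ j) \<le> 2 * norm w"
    using norm_triangle_ineq4[of "w $ i" "w $ j"] Finite_Cartesian_Product.norm_nth_le[of w i]
      Finite_Cartesian_Product.norm_nth_le[of w j]
    by simp
qed

lemma norm_le_sum_norm_nth: "norm w \<le> (\<Sum>i\<in>UNIV. norm (w $ i))"
  unfolding norm_vec_def by (rule L2_set_le_sum) simp

lemma norm_mean_le:
  fixes w :: "'v::real_normed_vector ^ 'a::finite"
  assumes "\<And>i. norm (w $ i) \<le> d"
  shows "norm (mean w) \<le> d"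
proof -
  have "norm (\<Sum>i\<in>UNIV. w $ i) \<le> real CARD('a) * d"
    by (rule sum_norm_bound) (rule assms)
  then show ?thesis
    by (simp add: mean_def field_simps)
qed

lemma mean_diff: "mean (u - w) = mean u - mean w"
  by (simp add: mean_def sum_subtractf algebra_simps)

lemma mean_add: "mean (u + w) = mean u + mean w"
  by (simp add: mean_def sum.distrib algebra_simps)

lemma mean_const [simp]: "mean (\<chi> i::'a::finite. c) = c"
  by (simp add: mean_def flip: scaleR_scaleR) (simp add: sum_constant_scaleR)

text \<open>The deviation from the mean is itself the mean of the differences
  \<open>w $ i - w $ j\<close> over \<open>j\<close>.\<close>

lemma norm_diff_mean: "norm (w $ i - mean w) \<le> spread w"
proof -
  have "norm (mean ((\<chi> j. w $ i) - w)) \<le> spread w"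
    by (rule norm_mean_le) (simp add: spread_ge)
  then show ?thesis
    by (simp add: mean_diff)
qed

text \<open>The Lipschitz hypotheses on the gradients speak of the norm of stacked vectors; this
  converts a spread into such a norm, with the crude factor \<open>N\<close> from summing over the
  rows.\<close>

lemma norm_diff_const_mean:
  fixes w :: "'v::real_normed_vector ^ 'a::finite"
  shows "norm (w - (\<chi> i. mean w)) \<le> real CARD('a) * spread w"
proof -
  have "norm (w - (\<chi> i. mean w)) \<le> (\<Sum>i\<in>UNIV. norm ((w - (\<chi> i. mean w)) $ i))"
    by (rule norm_le_sum_norm_nth)
  also have "\<dots> \<le> of_nat CARD('a) * spread w"
    by (rule sum_bounded_above) (simp add: norm_diff_mean)
  finally show ?thesis .
qed

section \<open>Averaging by doubly stochastic matrices\<close>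

lemma mix_mult: "mix (V ** W) w = mix V (mix W w)"
proof -
  have "(\<Sum>j\<in>UNIV. (\<Sum>k\<in>UNIV. V $ i $ k * W $ k $ j) *\<^sub>R w $ j) =
        (\<Sum>k\<in>UNIV. V $ i $ k *\<^sub>R (\<Sum>j\<in>UNIV. W $ k $ j *\<^sub>R w $ j))" for i
    unfolding scaleR_sum_left scaleR_sum_right scaleR_scaleR by (rule sum.swap)
  then show ?thesis
    by (simp add: mix_def matrix_matrix_mult_def vec_eq_iff)
qed

lemma mix_mat_1 [simp]: "mix (mat 1) w = w"
  by (simp add: mix_def mat_def vec_eq_iff if_distrib[where f = "\<lambda>r. r *\<^sub>R _"] cong: if_cong)

lemma mix_diff: "mix W (u - w) = mix W u - mix W w"
  by (simp add: mix_def vec_eq_iff scaleR_diff_right sum_subtractf)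

text \<open>After exchanging the sums, each \<open>w $ j\<close> carries a column sum of
  \<open>W\<close> as its weight, which is 1.\<close>

lemma mean_mix:
  assumes "doubly_stochastic W"
  shows "mean (mix W w) = mean w"
proof -
  have "(\<Sum>i\<in>UNIV. mix W w $ i) = (\<Sum>j\<in>UNIV. (\<Sum>i\<in>UNIV. W $ i $ j) *\<^sub>R w $ j)"
    unfolding mix_def vec_lambda_beta scaleR_sum_left by (rule sum.swap)
  also have "\<dots> = (\<Sum>j\<in>UNIV. w $ j)"
    using assms by (simp add: doubly_stochastic_def)
  finally show ?thesis
    by (simp add: mean_def)
qed

lemma doubly_stochastic_mat_1: "doubly_stochastic (mat 1)"
  by (auto simp: doubly_stochastic_def mat_def)

lemma doubly_stochastic_mult:
  assumes "doubly_stochastic V" "doubly_stochastic W"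
  shows "doubly_stochastic (V ** W)"
proof -
  have "(\<Sum>j\<in>UNIV. \<Sum>k\<in>UNIV. V $ i $ k * W $ k $ j) = 1" for i
    using assms by (subst sum.swap) (simp add: doubly_stochastic_def flip: sum_distrib_left)
  moreover have "(\<Sum>i\<in>UNIV. \<Sum>k\<in>UNIV. V $ i $ k * W $ k $ j) = 1" for j
    using assms by (subst sum.swap) (simp add: doubly_stochastic_def flip: sum_distrib_right)
  ultimately show ?thesis
    using assms by (auto simp: doubly_stochastic_def matrix_matrix_mult_def intro!: sum_nonneg)
qed

text \<open>Removing the common mass \<open>\<eta>\<close> from column \<open>c\<close> leaves rows of total mass \<open>1 - \<eta>\<close>; the
  difference of two rows is then averaged over the product of both remainders.\<close>

lemma spread_mix_le:
  assumes W: "doubly_stochastic W" and \<eta>: "\<And>i. \<eta> \<le> W $ i $ c"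
  shows "spread (mix W w) \<le> (1 - \<eta>) * spread w"
proof (rule spread_le)
  fix i j
  define u where "u i k = W $ i $ k - (if k = c then \<eta> else 0)" for i k
  define p where "p i = (\<Sum>k\<in>UNIV. u i k *\<^sub>R w $ k)" for i
  define s where "s = 1 - \<eta>"
  have u_nonneg: "0 \<le> u i k" for i k
    using W \<eta> by (auto simp: u_def doubly_stochastic_def)
  have u_sum: "(\<Sum>k\<in>UNIV. u i k) = s" for i
    using W by (simp add: u_def s_def doubly_stochastic_def sum_subtractf)
  have mix_nth: "mix W w $ i = p i + \<eta> *\<^sub>R w $ c" for i
  proof -
    have "p i = (\<Sum>k\<in>UNIV. W $ i $ k *\<^sub>R w $ k - (if k = c then \<eta> *\<^sub>R w $ k else 0))"
      unfolding p_def u_def by (rule sum.cong) (auto simp: scaleR_diff_left)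
    then show ?thesis
      by (simp add: sum_subtractf mix_def)
  qed
  have "0 \<le> s"
    using sum_nonneg[of UNIV "u i"] u_nonneg u_sum by simp
  have "norm (p i - p j) \<le> s * spread w"
  \<comment> \<open>The averaging below ends with a division by \<open>s\<close>. If
    \<open>s\<close> is 0, the remainders are nonnegative with sum 0 and hence vanish.\<close>
  proof (cases "s = 0")
    case True
    then have "u i k = 0" for i k
      using u_sum[of i] u_nonneg by (simp add: sum_nonneg_eq_0_iff)
    then show ?thesis
      using True by (simp add: p_def)
  next
    case False
    \<comment> \<open>The factor \<open>s\<close> is replaced by the total mass of the other row, so
      that \<open>p i\<close> and \<open>p j\<close> become double sums with the same weights and
      can be subtracted termwise.\<close>
    have "s *\<^sub>R p i = (\<Sum>k\<in>UNIV. (u i k * (\<Sum>l\<in>UNIV. u j l)) *\<^sub>R w $ k)"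
      by (simp add: p_def u_sum scaleR_sum_right mult.commute)
    also have "\<dots> = (\<Sum>k\<in>UNIV. \<Sum>l\<in>UNIV. (u i k * u j l) *\<^sub>R w $ k)"
      by (simp only: sum_distrib_left scaleR_sum_left)
    finally have mixed_i: "s *\<^sub>R p i = \<dots>" .
    have "s *\<^sub>R p j = (\<Sum>l\<in>UNIV. ((\<Sum>k\<in>UNIV. u i k) * u j l) *\<^sub>R w $ l)"
      by (simp add: p_def u_sum scaleR_sum_right)
    also have "\<dots> = (\<Sum>l\<in>UNIV. \<Sum>k\<in>UNIV. (u i k * u j l) *\<^sub>R w $ l)"
      by (simp only: sum_distrib_right scaleR_sum_left)
    also have "\<dots> = (\<Sum>k\<in>UNIV. \<Sum>l\<in>UNIV. (u i k * u j l) *\<^sub>R w $ l)"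
      by (rule sum.swap)
    finally have mixed_j: "s *\<^sub>R p j = \<dots>" .
    from mixed_i mixed_j have "s *\<^sub>R (p i - p j) =
        (\<Sum>k\<in>UNIV. \<Sum>l\<in>UNIV. (u i k * u j l) *\<^sub>R (w $ k - w $ l))"
      by (simp add: scaleR_diff_right sum_subtractf)
    also have "norm \<dots> \<le> (\<Sum>k\<in>UNIV. \<Sum>l\<in>UNIV. (u i k * u j l) * spread w)"
      using u_nonneg
      by (intro order_trans[OF norm_sum] sum_mono) (auto simp: spread_ge intro!: mult_left_mono)
    also have "\<dots> = (\<Sum>k\<in>UNIV. \<Sum>l\<in>UNIV. u i k * u j l) * spread w"
      by (simp only: sum_distrib_right)
    also have "\<dots> = s * (s * spread w)"
      by (simp add: u_sum flip: sum_product)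
    finally show ?thesis
      using False \<open>0 \<le> s\<close> by simp
  qed
  then show "norm (mix W w $ i - mix W w $ j) \<le> (1 - \<eta>) * spread w"
    by (simp add: mix_nth s_def)
qed

text \<open>If no arc left \<open>S\<close>, then \<open>S\<close> would be closed under
  reachability and would contain \<open>v\<close>.\<close>

lemma strongly_connected_crossing_arc:
  assumes "strongly_connected (with_proj \<lparr>pverts = UNIV, parcs = R\<rparr>)"
    and "u \<in> S" "v \<notin> S"
  obtains p q where "p \<in> S" "q \<notin> S" "(p, q) \<in> R"
proof -
  let ?G = "\<lparr>pverts = UNIV, parcs = R\<rparr>"
  have "u \<rightarrow>\<^sup>*\<^bsub>with_proj ?G\<^esub> v"
    using assms(1) by (auto simp: strongly_connected_def)
  then have "(u, v) \<in> (arcs_ends (with_proj ?G))\<^sup>*"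
    by (rule reachable_rtranclI)
  moreover have "arcs_ends (with_proj ?G) = R"
    by (auto simp: arcs_ends_def arc_to_ends_def)
  ultimately have "(u, v) \<in> R\<^sup>*"
    by simp
  then have "v \<in> S" if "\<And>p q. p \<in> S \<Longrightarrow> (p, q) \<in> R \<Longrightarrow> q \<in> S"
    by (induction rule: rtrancl_induct) (use assms(2) that in auto)
  with assms(3) that show thesis
    by blast
qed

section \<open>Propagation of influence and contraction of the spread\<close>

locale time_varying_network =
  fixes E :: "nat \<Rightarrow> ('a::finite \<times> 'a) set"
    and A :: "nat \<Rightarrow> real ^ 'a ^ 'a"
    and a :: real and Q :: nat
  assumes weights: "\<And>t. weight_matrix (E t) (A t)"
    and Q_pos: "Q > 0"
    and connected: "\<And>k. strongly_connected
      (with_proj \<lparr>pverts = UNIV, parcs = (\<Union>l\<in>{0..Q - 1}. E (k + l))\<rparr>)"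
    and stochastic: "\<And>t. doubly_stochastic (A t)"
    and a_range: "0 < a" "a < 1"
    and a_lower: "\<And>t i j. A t $ i $ j > 0 \<Longrightarrow> A t $ i $ j \<ge> a"
    and a_diag: "\<And>t i. A t $ i $ i \<ge> a"
begin

lemma transition_stochastic: "doubly_stochastic (transition A k m)"
  by (induction m) (auto intro: doubly_stochastic_mat_1 doubly_stochastic_mult stochastic)

text \<open>The agents to which \<open>j\<close> passes a guaranteed weight within \<open>m\<close>
  steps from time \<open>k\<close>. The threshold loses one factor \<open>a\<close> per step, which
  is exactly the price of following one positive weight.\<close>

definition reached :: "nat \<Rightarrow> 'a \<Rightarrow> nat \<Rightarrow> 'a set" where
  "reached k j m = {i. a ^ m \<le> transition A k m $ i $ j}"

text \<open>The route through \<open>p\<close> alone contributes \<open>a * a ^ m\<close> to the new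
  entry, and all other routes contribute nonnegative amounts.\<close>

lemma reached_step:
  assumes "p \<in> reached k j m" "a \<le> A (k + m) $ q $ p"
  shows "q \<in> reached k j (Suc m)"
proof -
  let ?P = "transition A k m"
  have "a ^ Suc m \<le> A (k + m) $ q $ p * ?P $ p $ j"
    using assms a_range by (simp add: reached_def) (intro mult_mono, auto)
  also have "\<dots> \<le> (\<Sum>i\<in>UNIV. A (k + m) $ q $ i * ?P $ i $ j)"
    using stochastic transition_stochastic
    by (intro member_le_sum) (auto simp: doubly_stochastic_def)
  finally show ?thesis
    by (simp add: reached_def matrix_matrix_mult_def)
qed

text \<open>Diagonal weights of at least \<open>a\<close> let an agent keep what it has
  received.\<close>

lemma reached_mono:
  assumes "m \<le> m'"
  shows "reached k j m \<subseteq> reached k j m'"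
  using assms
proof (induction m' rule: dec_induct)
  case (step n)
  then show ?case
    using reached_step a_diag by blast
qed simp

text \<open>The union graph of the window starting at \<open>k + m\<close> has an arc leaving the
  current set, so a new agent is gained by the end of that window.\<close>

lemma reached_crossing:
  assumes "j \<in> reached k j m" "reached k j m \<noteq> UNIV"
  shows "reached k j m \<subset> reached k j (m + Q)"
proof -
  obtain v where "v \<notin> reached k j m"
    using assms(2) by blast
  then obtain p q where pq: "p \<in> reached k j m" "q \<notin> reached k j m"
    "(p, q) \<in> (\<Union>l\<in>{0..Q - 1}. E (k + m + l))"
    using strongly_connected_crossing_arc[OF connected assms(1)] by metis
  then obtain l where l: "l \<le> Q - 1" "(p, q) \<in> E (k + (m + l))"
    by (auto simp: add.assoc)
  have "p \<noteq> q"
    using pq by blast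
  then have "a \<le> A (k + (m + l)) $ q $ p"
    using weights[of "k + (m + l)"] l(2) by (intro a_lower) (auto simp: weight_matrix_def)
  \<comment> \<open>The arc is active only at time \<open>k + (m + l)\<close>; until then
    \<open>p\<close> stays in the set by its diagonal weight.\<close>
  moreover have "p \<in> reached k j (m + l)"
    using pq(1) reached_mono[of m "m + l"] by auto
  ultimately have "q \<in> reached k j (Suc (m + l))"
    by (rule reached_step[rotated])
  moreover have "Suc (m + l) \<le> m + Q"
    using l(1) Q_pos by simp
  ultimately have "q \<in> reached k j (m + Q)"
    using reached_mono by blast
  then show ?thesis
    using pq(2) reached_mono[of m "m + Q" k j] by auto
qed

text \<open>Each window of length \<open>Q\<close> adds at least one agent until all are
  reached.\<close>

lemma reached_all: "reached k j (CARD('a) * Q) = UNIV"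
proof -
  have source: "j \<in> reached k j m" for m
    using reached_mono[of 0 m k j] by (auto simp: reached_def mat_def)
  \<comment> \<open>The strict inequality starts from \<open>j\<close> itself at
    \<open>n = 0\<close>. At \<open>n = N\<close> it is impossible, which leaves the first
    alternative.\<close>
  have "reached k j (n * Q) = UNIV \<or> n < card (reached k j (n * Q))" for n
  proof (induction n)
    case 0
    then show ?case
      using source[of 0] by (auto simp: card_gt_0_iff)
  next
    case (Suc n)
    have sub: "reached k j (n * Q) \<subseteq> reached k j (Suc n * Q)"
      by (rule reached_mono) simp
    show ?case
    proof (cases "reached k j (n * Q) = UNIV")
      case True
      then show ?thesis
        using sub by auto
    next
      case False
      then have "reached k j (n * Q) \<subset> reached k j (Suc n * Q)"
        using reached_crossing[OF source[of "n * Q"]] by (simp add: add.commute)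
      then have "card (reached k j (n * Q)) < card (reached k j (Suc n * Q))"
        by (intro psubset_card_mono) auto
      then show ?thesis
        using Suc False by auto
    qed
  qed
  from this[of "CARD('a)"] show ?thesis
    using card_mono[of UNIV "reached k j (CARD('a) * Q)"] by fastforce
qed

lemma spread_transition:
  "spread (mix (transition A k (CARD('a) * Q)) w) \<le> (1 - a ^ (CARD('a) * Q)) * spread w"
proof -
  have "a ^ (CARD('a) * Q) \<le> transition A k (CARD('a) * Q) $ i $ j" for i j
    using reached_all[of k j] by (auto simp: reached_def)
  then show ?thesis
    using transition_stochastic by (intro spread_mix_le)
qed

text \<open>The case \<eta> = 0 of the contraction estimate, where every column qualifies; hence the
  arbitrary choice \<open>undefined\<close>.\<close>

lemma spread_mix: "spread (mix (A t) w) \<le> spread w"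
  using spread_mix_le[OF stochastic, of 0 t undefined w] stochastic[of t]
  by (simp add: doubly_stochastic_def)

text \<open>The deviation from the unperturbed evolution obeys the same recursion, and later mixing
  cannot enlarge errors made earlier.\<close>

lemma spread_perturbed:
  assumes step: "\<And>t. w (Suc t) = mix (A t) (w t) + e t"
  shows "spread (w (t + m) - mix (transition A t m) (w t)) \<le> (\<Sum>s<m. spread (e (t + s)))"
proof (induction m)
  case 0
  then show ?case
    by (auto intro!: spread_le)
next
  case (Suc m)
  let ?d = "w (t + m) - mix (transition A t m) (w t)"
  have "w (t + Suc m) - mix (transition A t (Suc m)) (w t) = mix (A (t + m)) ?d + e (t + m)"
    by (simp add: step mix_mult mix_diff)
  also have "spread \<dots> \<le> spread ?d + spread (e (t + m))"
    using spread_add spread_mix by (smt (verit))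
  finally show ?case
    using Suc by simp
qed

lemma spread_perturbed_contraction:
  fixes w e :: "nat \<Rightarrow> 'v::real_normed_vector ^ 'a"
  defines "M \<equiv> CARD('a) * Q"
  assumes "\<And>t. w (Suc t) = mix (A t) (w t) + e t"
  shows "spread (w (t + M)) \<le> (1 - a ^ M) * spread (w t) + (\<Sum>s<M. spread (e (t + s)))"
proof -
  let ?m = "mix (transition A t M) (w t)"
  have "spread (w (t + M)) \<le> spread ?m + spread (w (t + M) - ?m)"
    using spread_add[of ?m "w (t + M) - ?m"] by simp
  then show ?thesis
    using spread_transition[of t "w t"] spread_perturbed[of w e t M, OF assms(2)]
    by (simp add: M_def)
qed

end

section \<open>Delayed contractions and square-root growth\<close>

lemma delayed_contraction_bounded:
  fixes u :: "nat \<Rightarrow> real"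
  assumes M: "M > 0" and \<rho>: "0 \<le> \<rho>" "\<rho> < 1" and nonneg: "\<And>t. 0 \<le> u t"
    and step: "\<And>t. u (t + M) \<le> \<rho> * u t + c"
  obtains K where "\<And>t. u t \<le> K"
proof
  \<comment> \<open>The first summand covers the initial window. The second is the fixed point of
    the recursion for \<open>\<bar>c\<bar>\<close>, which makes \<open>K\<close> invariant under one
    delayed step.\<close>
  define K where "K = (\<Sum>t<M. u t) + \<bar>c\<bar> / (1 - \<rho>)"
  have c: "c \<le> (1 - \<rho>) * (\<bar>c\<bar> / (1 - \<rho>))"
    using \<rho> by simp
  also have "\<dots> \<le> (1 - \<rho>) * K"
    using \<rho> nonneg by (intro mult_left_mono) (auto simp: K_def sum_nonneg)
  finally have K: "\<rho> * K + c \<le> K"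
    by (simp add: algebra_simps)
  fix t
  show "u t \<le> K"
  proof (induction t rule: less_induct)
    case (less t)
    show ?case
    proof (cases "t < M")
      case True
      then have "u t \<le> (\<Sum>t<M. u t)"
        using nonneg by (intro member_le_sum) auto
      then show ?thesis
        using \<rho> by (simp add: K_def add_increasing2)
    next
      case False
      then have "u t \<le> \<rho> * u (t - M) + c"
        using step[of "t - M"] by simp
      also have "\<dots> \<le> \<rho> * K + c"
        using less[of "t - M"] False M \<rho> by (simp add: mult_left_mono)
      finally show ?thesis
        using K by simp
    qed
  qed
qed

text \<open>Only an upper bound is recorded and \<open>C\<close> may have either sign, so
  monotonicity arguments in \<open>T\<close> pass to its absolute value.\<close>

definition sqrt_sums :: "(nat \<Rightarrow> real) \<Rightarrow> bool" where
  "sqrt_sums u \<longleftrightarrow> (\<exists>C. \<forall>T. (\<Sum>t<T. u t) \<le> C * sqrt (real T))"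

lemma sqrt_sums_mono:
  assumes "sqrt_sums v" "\<And>t. u t \<le> v t"
  shows "sqrt_sums u"
proof -
  obtain C where "(\<Sum>t<T. v t) \<le> C * sqrt (real T)" for T
    using assms(1) by (auto simp: sqrt_sums_def)
  then have "(\<Sum>t<T. u t) \<le> C * sqrt (real T)" for T
    using sum_mono[of "{..<T}" u v] assms(2) by (meson order_trans)
  then show ?thesis
    by (auto simp: sqrt_sums_def)
qed

lemma sqrt_sums_add:
  assumes "sqrt_sums u" "sqrt_sums v"
  shows "sqrt_sums (\<lambda>t. u t + v t)"
proof -
  obtain C D where "(\<Sum>t<T. u t) \<le> C * sqrt (real T)" "(\<Sum>t<T. v t) \<le> D * sqrt (real T)" for T
    using assms by (auto simp: sqrt_sums_def)
  then have "(\<Sum>t<T. u t + v t) \<le> (C + D) * sqrt (real T)" for T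
    by (simp add: sum.distrib distrib_right add_mono)
  then show ?thesis
    by (auto simp: sqrt_sums_def)
qed

lemma sqrt_sums_cmult:
  assumes "sqrt_sums u" "0 \<le> c"
  shows "sqrt_sums (\<lambda>t. c * u t)"
proof -
  obtain C where "(\<Sum>t<T. u t) \<le> C * sqrt (real T)" for T
    using assms by (auto simp: sqrt_sums_def)
  then have "(\<Sum>t<T. c * u t) \<le> (c * C) * sqrt (real T)" for T
    using assms(2) by (simp add: mult.assoc mult_left_mono flip: sum_distrib_left)
  then show ?thesis
    by (auto simp: sqrt_sums_def)
qed

text \<open>Summing the recursion over \<open>t < T\<close> reproduces the sum of \<open>u\<close>
  with the factor \<rho> < 1, which is then absorbed on the left.\<close>

lemma sqrt_sums_delayed_contraction:
  fixes u e :: "nat \<Rightarrow> real"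
  assumes \<rho>: "\<rho> < 1" and u_nonneg: "\<And>t. 0 \<le> u t" and e_nonneg: "\<And>t. 0 \<le> e t"
    and step: "\<And>t. u (t + M) \<le> \<rho> * u t + (\<Sum>s<M. e (t + s))"
    and e: "sqrt_sums e"
  shows "sqrt_sums u"
proof -
  obtain C where C: "(\<Sum>t<T. e t) \<le> C * sqrt (real T)" for T
    using e by (auto simp: sqrt_sums_def)
  define U where "U = (\<Sum>t<M. u t)"
  define D where "D = (U + real M * (\<bar>C\<bar> * sqrt (1 + real M))) / (1 - \<rho>)"
  have "(\<Sum>t<T. u t) \<le> D * sqrt (real T)" for T
  proof (cases "T = 0")
    case False
    \<comment> \<open>Shifting enlarges the range to at most \<open>T + M\<close>, and
      \<open>T + M\<close> is at most \<open>(1 + M) * T\<close> because \<open>T\<close> is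
      positive.\<close>
    have shifted: "(\<Sum>t<T. e (t + s)) \<le> \<bar>C\<bar> * sqrt (1 + real M) * sqrt (real T)" if "s < M" for s
    proof -
      have "(\<Sum>t<T. e (t + s)) = (\<Sum>t\<in>(\<lambda>t. t + s) ` {..<T}. e t)"
        by (simp add: sum.reindex inj_on_def)
      also have "\<dots> \<le> (\<Sum>t<T + M. e t)"
        using e_nonneg that by (intro sum_mono2) auto
      also have "\<dots> \<le> \<bar>C\<bar> * sqrt (real (T + M))"
        using C[of "T + M"] by (smt (verit) mult_right_mono real_sqrt_ge_zero of_nat_0_le_iff)
      also have "\<dots> \<le> \<bar>C\<bar> * sqrt ((1 + real M) * real T)"
        using False mult_left_mono[of 1 "real T" "real M"]
        by (intro mult_left_mono) (auto simp: algebra_simps)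
      finally show ?thesis
        by (simp add: real_sqrt_mult)
    qed
    have "(\<Sum>t<T. u t) \<le> (\<Sum>t<M + T. u t)"
      using u_nonneg by (intro sum_mono2) auto
    also have "\<dots> = U + (\<Sum>t<T. u (t + M))"
      unfolding U_def by (induction T) (auto simp: add.commute)
    also have "(\<Sum>t<T. u (t + M)) \<le> (\<Sum>t<T. \<rho> * u t + (\<Sum>s<M. e (t + s)))"
      by (intro sum_mono step)
    also have "\<dots> = \<rho> * (\<Sum>t<T. u t) + (\<Sum>s<M. \<Sum>t<T. e (t + s))"
      by (simp add: sum.distrib sum_distrib_left sum.swap[of _ "{..<M}"])
    also have "(\<Sum>s<M. \<Sum>t<T. e (t + s)) \<le> (\<Sum>s<M. \<bar>C\<bar> * sqrt (1 + real M) * sqrt (real T))"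
      by (intro sum_mono shifted) auto
    finally have "(1 - \<rho>) * (\<Sum>t<T. u t) \<le>
        U + real M * (\<bar>C\<bar> * sqrt (1 + real M)) * sqrt (real T)"
      by (simp add: algebra_simps)
    \<comment> \<open>The contribution of the initial window is constant; it fits the rate since
      \<open>sqrt T\<close> is at least 1.\<close>
    also have "U \<le> U * sqrt (real T)"
      using False u_nonneg mult_left_mono[of 1 "sqrt (real T)" U] by (simp add: U_def sum_nonneg)
    finally have "(1 - \<rho>) * (\<Sum>t<T. u t) \<le>
        (U + real M * (\<bar>C\<bar> * sqrt (1 + real M))) * sqrt (real T)"
      by (simp add: algebra_simps)
    then show ?thesis
      using \<rho> by (simp add: D_def field_simps)
  qed simp
  then show ?thesis
    by (auto simp: sqrt_sums_def)
qed

text \<open>Comparison with a telescoping sum: for consecutive roots \<open>r\<close> and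
  \<open>s\<close>, 1 = (s - r)(s + r) and s \<le> 2 r give 1 / r \<le> 3 (s - r), whence the
  constant 3.\<close>

lemma sqrt_sums_stepsize:
  fixes \<alpha> :: "nat \<Rightarrow> real"
  assumes "\<And>t. \<alpha> t = (if t = 0 then 1 else 1 / sqrt (real t))"
  shows "sqrt_sums \<alpha>"
proof -
  have "(\<Sum>t<T. \<alpha> t) \<le> 3 * sqrt (real T) - (if T = 0 then 0 else 1)" for T
  proof (induction T)
    case (Suc T)
    show ?case
    proof (cases "T = 0")
      case False
      define r s where "r = sqrt (real T)" and "s = sqrt (real (Suc T))"
      have rs: "0 < r" "r \<le> s" "s * s = r * r + 1" "1 \<le> r"
        using False by (auto simp: r_def s_def)
      have "s \<le> 2 * r"
      proof (rule power2_le_imp_le)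
        have "1 \<le> r * r"
          using mult_mono[of 1 r 1 r] rs by simp
        then show "s\<^sup>2 \<le> (2 * r)\<^sup>2"
          using rs(3) by (simp add: power2_eq_square)
      qed (use rs in simp)
      have "(s - r) * (s + r) = 1"
        using rs(3) by (simp add: algebra_simps)
      moreover have "(s - r) * (s + r) \<le> (s - r) * (3 * r)"
        using \<open>s \<le> 2 * r\<close> rs by (intro mult_left_mono) auto
      ultimately have "1 / r \<le> 3 * (s - r)"
        using rs(1) by (simp add: field_simps)
      then show ?thesis
        using Suc False assms[of T] by (simp add: r_def s_def)
    qed (simp add: assms)
  qed simp
  then have "(\<Sum>t<T. \<alpha> t) \<le> 3 * sqrt (real T)" for T
    by (smt (verit))
  then show ?thesis
    by (auto simp: sqrt_sums_def)
qed

section \<open>Blocks and gradients\<close>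

lemma block_nth [simp]: "block own i u $ k = (if own k = i then u $ k else 0)"
  by (simp add: block_def)

lemma linear_block: "linear (block own i)"
  by (rule linearI) (auto simp: vec_eq_iff)

lemmas block_diff = linear_diff[OF linear_block]
  and block_sum = linear_sum[OF linear_block]

lemma bounded_linear_block: "bounded_linear (block own i)"
  for own :: "'n::finite \<Rightarrow> 'a"
  by (intro linear_conv_bounded_linear[THEN iffD1] linear_block)

lemma block_block [simp]: "block own i (block own i u) = block own i u"
  by (simp add: vec_eq_iff)

lemma block_of_block_space: "u \<in> block_space own i \<Longrightarrow> block own i u = u"
  by (auto simp: vec_eq_iff block_space_def)

lemma block_of_other_block_space:
  "u \<in> block_space own j \<Longrightarrow> i \<noteq> j \<Longrightarrow> block own i u = 0"
  by (auto simp: vec_eq_iff block_space_def)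

lemma inner_block: "block own i u \<bullet> v = u \<bullet> block own i v"
  by (auto simp: inner_vec_def intro!: sum.cong)

lemma sum_block: "(\<Sum>i\<in>UNIV. block own i u) = u"
  for own :: "'n::finite \<Rightarrow> 'a::finite"
  by (simp add: vec_eq_iff)

lemma sum_inner_block: "(\<Sum>i\<in>UNIV. block own i u \<bullet> block own i v) = u \<bullet> v"
  for own :: "'n::finite \<Rightarrow> 'a::finite"
  by (simp add: inner_block sum_block flip: inner_sum_right)

lemma norm_block_le: "norm (block own i u) \<le> norm u"
  for own :: "'n::finite \<Rightarrow> 'a::finite"
  by (rule norm_le_componentwise_cart) auto

lemma norm_le_sum_norm_block: "norm u \<le> (\<Sum>i\<in>UNIV. norm (block own i u))"
  for own :: "'n::finite \<Rightarrow> 'a::finite"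
  using norm_sum[of "\<lambda>i. block own i u" UNIV] by (simp add: sum_block)

lemma convex_block_product:
  fixes own :: "'n::finite \<Rightarrow> 'a"
  assumes "\<And>i. convex (X i)"
  shows "convex (block_product own X)"
proof -
  have "block_product own X = (\<Inter>i. block own i -` X i)"
    by (auto simp: block_product_def)
  then show ?thesis
    using assms by (auto intro!: convex_INT convex_linear_vimage linear_block)
qed

text \<open>Some hypotheses are stated at points of the product; this carries them to single points
  of one \<open>X i\<close>.\<close>

lemma block_product_extend:
  fixes own :: "'n::finite \<Rightarrow> 'a::finite"
  assumes X: "\<And>j. X j \<noteq> {}" "\<And>j. X j \<subseteq> block_space own j" and v: "v \<in> X i"
  obtains u where "u \<in> block_product own X" "block own i u = v"
proof
  define w where "w = (\<lambda>j. SOME u. u \<in> X j)(i := v)"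
  have w: "w j \<in> X j" for j
    using X(1) v by (auto simp: w_def some_in_eq)
  \<comment> \<open>Distinct block spaces have disjoint coordinates, so the sum concatenates the
    chosen vectors.\<close>
  have "block own j (\<Sum>k\<in>UNIV. w k) = w j" for j
  proof -
    have "block own j (w k) = (if k = j then w j else 0)" for k
      using block_of_block_space[of "w k" own k] block_of_other_block_space[of "w k" own k j]
        subsetD[OF X(2) w] by auto
    then show ?thesis
      by (simp add: block_sum)
  qed
  then show "(\<Sum>k\<in>UNIV. w k) \<in> block_product own X" "block own i (\<Sum>k\<in>UNIV. w k) = v"
    using w by (auto simp: block_product_def w_def)
qed

section \<open>Gradients and the derivative of the total loss\<close>

lemma GDERIV_unique:
  assumes "GDERIV g x :> D" "GDERIV g x :> D'"
  shows "D = D'"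
proof -
  have "(\<lambda>h. h \<bullet> D) = (\<lambda>h. h \<bullet> D')"
    using assms unfolding gderiv_def by (rule has_derivative_unique)
  from fun_cong[OF this, of "D - D'"] have "(D - D') \<bullet> (D - D') = 0"
    by (simp add: inner_diff_right)
  then show ?thesis
    by simp
qed

lemma gradient_eqI: "GDERIV g x :> D \<Longrightarrow> gradient g x = D"
  unfolding gradient_def using GDERIV_unique by blast

text \<open>The Riesz representative of the derivative is written out in the basis; it witnesses
  existence for the definite description in \<open>gradient\<close>.\<close>

lemma inner_gradient:
  fixes g :: "'b::euclidean_space \<Rightarrow> real"
  assumes "(g has_derivative g') (at x)"
  shows "h \<bullet> gradient g x = g' h"
proof -
  interpret bounded_linear g'
    using assms by (rule has_derivative_bounded_linear)
  have riesz: "h \<bullet> (\<Sum>b\<in>Basis. g' b *\<^sub>R b) = g' h" for h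
  proof -
    have "h \<bullet> (\<Sum>b\<in>Basis. g' b *\<^sub>R b) = g' (\<Sum>b\<in>Basis. (h \<bullet> b) *\<^sub>R b)"
      by (simp add: inner_sum_right sum scaleR mult.commute)
    then show ?thesis
      by (simp add: euclidean_representation)
  qed
  then have "GDERIV g x :> (\<Sum>b\<in>Basis. g' b *\<^sub>R b)"
    using assms by (simp add: gderiv_def)
  then show ?thesis
    using riesz by (simp add: gradient_eqI)
qed

text \<open>Composing \<open>g\<close> with the block projection does not change it, so its
  derivative ignores other coordinates; self-adjointness of the projection moves this to the
  gradient.\<close>

lemma block_gradient:
  fixes own :: "'n::finite \<Rightarrow> 'a::finite"
  assumes dep: "depends_on_block own i g" and diff: "g differentiable (at (block own i u))"
  shows "block own i (gradient g (block own i u)) = gradient g (block own i u)"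
proof -
  let ?z = "block own i u"
  obtain g' where g': "(g has_derivative g') (at ?z)"
    using diff by (auto simp: differentiable_def)
  have "((\<lambda>v. g (block own i v)) has_derivative (\<lambda>h. g' (block own i h))) (at ?z)"
    using has_derivative_compose[OF bounded_linear_imp_has_derivative[OF bounded_linear_block],
        of g g' own i ?z UNIV] g' by simp
  moreover have "(\<lambda>v. g (block own i v)) = g"
    using dep by (auto simp: depends_on_block_def)
  ultimately have "(g has_derivative (\<lambda>h. g' (block own i h))) (at ?z)"
    by simp
  with g' have "g' = (\<lambda>h. g' (block own i h))"
    by (rule has_derivative_unique)
  then have "g' h = g' (block own i h)" for h
    by (rule fun_cong)
  then have "h \<bullet> gradient g ?z = h \<bullet> block own i (gradient g ?z)" for h
    by (simp only: inner_gradient[OF g'] inner_block[symmetric])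
  then show ?thesis
    by (intro vector_eq_ldot[THEN iffD1]) simp
qed

lemma has_derivative_gradients:
  fixes f :: "'b::euclidean_space \<times> 'c::euclidean_space \<Rightarrow> real"
  assumes "f differentiable (at (x, y))"
  shows "(f has_derivative (\<lambda>(h, k). h \<bullet> gradient1 f x y + k \<bullet> gradient2 f x y)) (at (x, y))"
proof -
  obtain f' where f': "(f has_derivative f') (at (x, y))"
    using assms by (auto simp: differentiable_def)
  interpret bounded_linear f'
    using f' by (rule has_derivative_bounded_linear)
  have "((\<lambda>u. f (u, y)) has_derivative (\<lambda>h. f' (h, 0))) (at x)"
    by (rule has_derivative_compose[where f = "\<lambda>u. (u, y)", OF _ f'])
      (auto intro!: derivative_eq_intros)
  moreover have "((\<lambda>v. f (x, v)) has_derivative (\<lambda>k. f' (0, k))) (at y)"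
    by (rule has_derivative_compose[where f = "\<lambda>v. (x, v)", OF _ f'])
      (auto intro!: derivative_eq_intros)
  ultimately have "h \<bullet> gradient1 f x y + k \<bullet> gradient2 f x y = f' (h, k)" for h k
    using add[of "(h, 0)" "(0, k)"] by (simp add: gradient1_def gradient2_def inner_gradient)
  then show ?thesis
    using f' by (simp add: case_prod_beta')
qed

lemma vec_gradient_adjoint: "h \<bullet> (vec_gradient g x *v y) = (jacobian g (at x) *v h) \<bullet> y"
  by (simp add: vec_gradient_def inner_commute[of h] dot_lmul_matrix inner_commute[of y])

lemma has_derivative_jacobian:
  fixes g :: "real ^ 'n::finite \<Rightarrow> real ^ 'd::finite"
  assumes "g differentiable_on UNIV"
  shows "(g has_derivative (\<lambda>h. jacobian g (at x) *v h)) (at x)"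
  using assms jacobian_works[of g "at x"] by (simp add: differentiable_on_def)

text \<open>The mean value inequality needs the Jacobian, whereas the bound is on its transpose; the
  two operator norms are compared by hand.\<close>

lemma lipschitz_of_vec_gradient_bound:
  fixes g :: "real ^ 'n::finite \<Rightarrow> real ^ 'd::finite"
  assumes diff: "g differentiable_on UNIV" and S: "convex S" "u \<in> S" "v \<in> S"
    and bound: "\<And>z. z \<in> S \<Longrightarrow> onorm ((*v) (vec_gradient g z)) \<le> G"
  shows "norm (g u - g v) \<le> G * norm (u - v)"
proof (rule differentiable_bound[OF S(1) _ _ S(2,3)])
  show "(g has_derivative (*v) (jacobian g (at z))) (at z within S)" for z
    using has_derivative_jacobian[OF diff] by (rule has_derivative_at_withinI)
  fix z assume z: "z \<in> S"
  show "onorm ((*v) (jacobian g (at z))) \<le> G"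
  proof (rule onorm_le)
    fix h
    let ?k = "jacobian g (at z) *v h"
    \<comment> \<open>With \<open>J\<close> the Jacobian, the squared norm of \<open>J h\<close> is
      the inner product of \<open>h\<close> with the transpose applied to \<open>J h\<close>; one
      factor \<open>norm ?k\<close> cancels at the end.\<close>
    have "norm ?k * norm ?k = h \<bullet> (vec_gradient g z *v ?k)"
      by (simp add: vec_gradient_adjoint norm_eq_sqrt_inner)
    also have "\<dots> \<le> norm h * norm (vec_gradient g z *v ?k)"
      by (rule norm_cauchy_schwarz)
    also have "\<dots> \<le> norm h * (onorm ((*v) (vec_gradient g z)) * norm ?k)"
      by (intro mult_left_mono onorm) auto
    also have "\<dots> \<le> norm h * (G * norm ?k)"
      using bound[OF z] by (intro mult_left_mono mult_right_mono) auto
    finally have *: "norm ?k * norm ?k \<le> (G * norm h) * norm ?k"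
      by (simp add: ac_simps)
    have "0 \<le> G"
      using onorm_pos_le[OF matrix_vector_mul_bounded_linear] bound[OF z] by (rule order_trans)
    then show "norm ?k \<le> G * norm h"
      using * by (cases "?k = 0") auto
  qed
qed

lemma has_derivative_aggregate:
  fixes own :: "'n::finite \<Rightarrow> 'a::finite" and \<psi> :: "'a \<Rightarrow> real ^ 'n \<Rightarrow> real ^ 'd::finite"
  assumes "\<And>i. \<psi> i differentiable_on UNIV"
  shows "(aggregate own \<psi> has_derivative (\<lambda>h. (1 / real CARD('a)) *\<^sub>R
    (\<Sum>i\<in>UNIV. jacobian (\<psi> i) (at (block own i u)) *v block own i h))) (at u)"
  unfolding aggregate_def[abs_def]
  by (intro has_derivative_scaleR_right has_derivative_sum
      has_derivative_compose[OF bounded_linear_imp_has_derivative[OF bounded_linear_block]]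
      has_derivative_jacobian assms)

text \<open>Block \<open>i\<close> of the gradient of the total loss. The mean of the second
  gradients arises because every loss sees \<open>\<psi> i\<close> through the aggregate with weight
  \<open>1 / N\<close>.\<close>

definition loss_gradient ::
  "('n::finite \<Rightarrow> 'a::finite) \<Rightarrow> ('a \<Rightarrow> real ^ 'n \<Rightarrow> real ^ 'd::finite) \<Rightarrow>
   ('a \<Rightarrow> (real ^ 'n) \<times> (real ^ 'd) \<Rightarrow> real) \<Rightarrow> real ^ 'n \<Rightarrow> 'a \<Rightarrow> real ^ 'n" where
  "loss_gradient own \<psi> f u i =
     gradient1 (f i) (block own i u) (aggregate own \<psi> u) +
     vec_gradient (\<psi> i) (block own i u) *v
       mean (stacked_gradient2 own f u (\<chi> j. aggregate own \<psi> u))"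

lemma has_derivative_total_loss:
  fixes own :: "'n::finite \<Rightarrow> 'a::finite" and \<psi> :: "'a \<Rightarrow> real ^ 'n \<Rightarrow> real ^ 'd::finite"
  assumes \<psi>: "\<And>i. \<psi> i differentiable_on UNIV" and f: "\<And>i. f i differentiable_on UNIV"
  shows "(total_loss own \<psi> f has_derivative
    (\<lambda>h. \<Sum>i\<in>UNIV. block own i h \<bullet> loss_gradient own \<psi> f u i)) (at u)"
proof -
  let ?z = "\<lambda>i. block own i u" and ?c = "aggregate own \<psi> u"
  let ?J = "\<lambda>i h. jacobian (\<psi> i) (at (?z i)) *v block own i h"
  let ?k = "\<lambda>h. (1 / real CARD('a)) *\<^sub>R (\<Sum>i\<in>UNIV. ?J i h)"
  let ?g1 = "\<lambda>i. gradient1 (f i) (?z i) ?c" and ?g2 = "\<lambda>i. gradient2 (f i) (?z i) ?c"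
  have "((\<lambda>v. f i (block own i v, aggregate own \<psi> v)) has_derivative
      (\<lambda>h. block own i h \<bullet> ?g1 i + ?k h \<bullet> ?g2 i)) (at u)" for i
  proof -
    have "(f i has_derivative (\<lambda>(h, k). h \<bullet> ?g1 i + k \<bullet> ?g2 i)) (at (?z i, ?c))"
      using f by (intro has_derivative_gradients) (auto simp: differentiable_on_def)
    from has_derivative_compose[OF has_derivative_Pair[OF
          bounded_linear_imp_has_derivative[OF bounded_linear_block]
          has_derivative_aggregate[OF \<psi>]] this]
    show ?thesis
      by simp
  qed
  then have "(total_loss own \<psi> f has_derivative
      (\<lambda>h. \<Sum>i\<in>UNIV. block own i h \<bullet> ?g1 i + ?k h \<bullet> ?g2 i)) (at u)"
    unfolding total_loss_def[abs_def] by (intro has_derivative_sum)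
  moreover have "(\<Sum>i\<in>UNIV. block own i h \<bullet> ?g1 i + ?k h \<bullet> ?g2 i) =
      (\<Sum>i\<in>UNIV. block own i h \<bullet> loss_gradient own \<psi> f u i)" for h
  proof -
    \<comment> \<open>The factor \<open>1 / N\<close> moves from the derivative of the aggregate to
      the second gradients and turns their sum into a mean.\<close>
    have "(\<Sum>i\<in>UNIV. ?k h \<bullet> ?g2 i) =
        (\<Sum>j\<in>UNIV. ?J j h) \<bullet> mean (stacked_gradient2 own f u (\<chi> j. ?c))"
      by (simp add: mean_def stacked_gradient2_def inner_sum_right sum_distrib_left)
    also have "\<dots> = (\<Sum>j\<in>UNIV. block own j h \<bullet>
        (vec_gradient (\<psi> j) (?z j) *v mean (stacked_gradient2 own f u (\<chi> j. ?c))))"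
      by (simp add: inner_sum_left vec_gradient_adjoint)
    finally show ?thesis
      by (simp add: loss_gradient_def inner_add_right sum.distrib)
  qed
  ultimately show ?thesis
    by simp
qed

text \<open>Restriction to the line through \<open>x\<close> and \<open>y\<close> reduces this to
  the tangent inequality in one real variable.\<close>

lemma convex_on_above_tangent:
  fixes F :: "'b::real_normed_vector \<Rightarrow> real"
  assumes conv: "convex_on UNIV F" and deriv: "(F has_derivative F') (at x)"
  shows "F x + F' (y - x) \<le> F y"
proof -
  define \<phi> where "\<phi> s = F (x + s *\<^sub>R (y - x))" for s
  have "convex_on UNIV \<phi>"
  proof (rule convex_onI)
    fix t s r :: real
    assume t: "0 < t" "t < 1"
    have "x + ((1 - t) * s + t * r) *\<^sub>R (y - x) =
        (1 - t) *\<^sub>R (x + s *\<^sub>R (y - x)) + t *\<^sub>R (x + r *\<^sub>R (y - x))"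
      by (simp add: algebra_simps)
    then show "\<phi> ((1 - t) *\<^sub>R s + t *\<^sub>R r) \<le> (1 - t) * \<phi> s + t * \<phi> r"
      using convex_onD[OF conv, of t] t by (simp add: \<phi>_def)
  qed simp
  moreover have "(\<phi> has_real_derivative F' (y - x)) (at 0 within UNIV)"
  proof -
    interpret bounded_linear F'
      using deriv by (rule has_derivative_bounded_linear)
    have "((\<lambda>s. x + s *\<^sub>R (y - x)) has_derivative (\<lambda>s. s *\<^sub>R (y - x))) (at 0)"
      by (auto intro!: derivative_eq_intros)
    then have "(\<phi> has_derivative (\<lambda>s. F' (s *\<^sub>R (y - x)))) (at 0)"
      unfolding \<phi>_def by (rule has_derivative_compose) (simp add: deriv)
    then show ?thesis
      by (simp add: has_field_derivative_def scaleR mult_commute_abs)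
  qed
  ultimately have "\<phi> 1 - \<phi> 0 \<ge> F' (y - x) * (1 - 0)"
    by (intro convex_on_imp_above_tangent) auto
  then show ?thesis
    by (simp add: \<phi>_def)
qed

text \<open>Projection is nonexpansive and fixes \<open>u\<close>; the rest is expanding a
  square.\<close>

lemma projected_step:
  fixes S :: "'b::euclidean_space set"
  assumes S: "convex S" "closed S" "u \<in> S"
  shows "(norm (closest_point S (z - \<alpha> *\<^sub>R d) - u))\<^sup>2
    \<le> (norm (z - u))\<^sup>2 - 2 * \<alpha> * (d \<bullet> (z - u)) + \<alpha>\<^sup>2 * (norm d)\<^sup>2"
proof -
  have "norm (closest_point S (z - \<alpha> *\<^sub>R d) - u) \<le> norm (z - \<alpha> *\<^sub>R d - u)"
    using closest_point_lipschitz[OF S(1,2), of "z - \<alpha> *\<^sub>R d" u] closest_point_self[OF S(3)] S(3)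
    by (auto simp: dist_norm)
  then have "(norm (closest_point S (z - \<alpha> *\<^sub>R d) - u))\<^sup>2 \<le> (norm ((z - u) - \<alpha> *\<^sub>R d))\<^sup>2"
    by (intro power_mono) (auto simp: algebra_simps)
  also have "\<dots> = (norm (z - u))\<^sup>2 - 2 * \<alpha> * (d \<bullet> (z - u)) + \<alpha>\<^sup>2 * (norm d)\<^sup>2"
    unfolding power2_norm_eq_inner inner_diff_left[of "z - u"] inner_diff_right[of _ "z - u"]
    by (simp add: inner_commute[of "z - u" d] power2_eq_square)
  finally show ?thesis .
qed

section \<open>Convergence of gradient tracking\<close>

text \<open>Summation by parts in inductive form: \<open>K - D (Suc T)\<close> is nonnegative, so
  its weight may grow from \<open>sqrt T\<close> to \<open>sqrt (Suc T)\<close>, after which the new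
  term telescopes.\<close>

lemma sum_sqrt_telescope_le:
  fixes D :: "nat \<Rightarrow> real"
  assumes "\<And>t. D t \<le> K"
  shows "(\<Sum>t=1..T. sqrt (real t) * (D t - D (Suc t))) \<le> sqrt (real T) * (K - D (Suc T))"
proof (induction T)
  case (Suc T)
  have "sqrt (real T) * (K - D (Suc T)) \<le> sqrt (real (Suc T)) * (K - D (Suc T))"
    using assms by (intro mult_right_mono) auto
  with Suc show ?case
    by (simp add: algebra_simps)
qed simp

locale gradient_tracking = time_varying_network E A a Q
  for E :: "nat \<Rightarrow> ('a::finite \<times> 'a) set" and A :: "nat \<Rightarrow> real ^ 'a ^ 'a"
    and a :: real and Q :: nat +
  fixes own :: "'n::finite \<Rightarrow> 'a"
    and X :: "'a \<Rightarrow> (real ^ 'n) set"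
    and \<psi> :: "'a \<Rightarrow> real ^ 'n \<Rightarrow> real ^ 'd::finite"
    and f :: "'a \<Rightarrow> (real ^ 'n) \<times> (real ^ 'd) \<Rightarrow> real"
    and \<alpha> :: "nat \<Rightarrow> real"
    and x :: "nat \<Rightarrow> real ^ 'n"
    and \<nu> y :: "nat \<Rightarrow> real ^ 'd ^ 'a"
    and B L G :: real
  assumes X_sub: "\<And>i. X i \<subseteq> block_space own i"
    and f_block: "\<And>i v. depends_on_block own i (\<lambda>u. f i (u, v))"
    and \<psi>_diff: "\<And>i. \<psi> i differentiable_on UNIV"
    and f_diff: "\<And>i. f i differentiable_on UNIV"
    and X_nonempty: "\<And>i. X i \<noteq> {}"
    and X_convex: "\<And>i. convex (X i)"
    and X_closed: "\<And>i. closed (X i)"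
    and X_bound: "\<And>i u. u \<in> X i \<Longrightarrow> norm u \<le> B"
    and f_convex: "convex_on UNIV (total_loss own \<psi> f)"
    and L_nonneg: "0 \<le> L"
    and grad1_lipschitz: "\<And>u u' v v'. u \<in> block_product own X \<Longrightarrow> u' \<in> block_product own X \<Longrightarrow>
      norm (stacked_gradient1 own f u v - stacked_gradient1 own f u' v')
        \<le> L * (norm (u - u') + norm (v - v'))"
    and grad2_lipschitz: "\<And>u u' v v'. u \<in> block_product own X \<Longrightarrow> u' \<in> block_product own X \<Longrightarrow>
      norm (stacked_gradient2 own f u v - stacked_gradient2 own f u' v')
        \<le> L * (norm (u - u') + norm (v - v'))"
    and G_nonneg: "0 \<le> G"
    and grad1_bound: "\<And>u v. u \<in> block_product own X \<Longrightarrow> norm (stacked_gradient1 own f u v) \<le> G"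
    and grad2_bound: "\<And>u v. u \<in> block_product own X \<Longrightarrow> norm (stacked_gradient2 own f u v) \<le> G"
    and grad_\<psi>_bound: "\<And>u i. u \<in> block_product own X \<Longrightarrow>
      onorm ((*v) (vec_gradient (\<psi> i) (block own i u))) \<le> G"
    and stepsize: "\<And>t. \<alpha> t = (if t = 0 then 1 else 1 / sqrt (real t))"
    and algorithm: "DGT own X \<psi> f A \<alpha> x \<nu> y"
begin

abbreviation z :: "nat \<Rightarrow> 'a \<Rightarrow> real ^ 'n" where
  "z t i \<equiv> block own i (x t)"

definition direction :: "nat \<Rightarrow> 'a \<Rightarrow> real ^ 'n" where
  "direction t i = gradient1 (f i) (z t i) (\<nu> t $ i) + vec_gradient (\<psi> i) (z t i) *v (y t $ i)"

definition \<psi>_change :: "nat \<Rightarrow> real ^ 'd ^ 'a" where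
  "\<psi>_change t = (\<chi> i. \<psi> i (z (Suc t) i) - \<psi> i (z t i))"

definition local_gradient2 :: "nat \<Rightarrow> real ^ 'd ^ 'a" where
  "local_gradient2 t = stacked_gradient2 own f (x t) (\<nu> t)"

section \<open>Feasibility, tracking of means and boundedness\<close>

lemma stepsize_pos: "0 < \<alpha> t"
  by (simp add: stepsize)

lemma z_step: "z (Suc t) i = closest_point (X i) (z t i - \<alpha> t *\<^sub>R direction t i)"
  using algorithm by (simp add: DGT_def direction_def)

lemma z_mem: "z t i \<in> X i"
proof (cases t)
  case 0
  then show ?thesis
    using algorithm by (simp add: DGT_def)
next
  case (Suc s)
  then show ?thesis
    by (simp add: z_step closest_point_in_set X_closed X_nonempty)
qed

lemma x_mem: "x t \<in> block_product own X"
  by (simp add: block_product_def z_mem)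

lemma \<nu>_step: "\<nu> (Suc t) = mix (A t) (\<nu> t) + \<psi>_change t"
  using algorithm by (simp add: DGT_def mix_def \<psi>_change_def vec_eq_iff[where 'b = 'a])

lemma y_step: "y (Suc t) = mix (A t) (y t) + (local_gradient2 (Suc t) - local_gradient2 t)"
  using algorithm
  by (simp add: DGT_def mix_def local_gradient2_def stacked_gradient2_def vec_eq_iff[where 'b = 'a])

text \<open>Mixing preserves the mean and the correction terms telescope, starting from an exact
  initialization.\<close>

lemma mean_\<nu>: "mean (\<nu> t) = aggregate own \<psi> (x t)"
proof (induction t)
  case 0
  then show ?case
    using algorithm by (simp add: DGT_def mean_def aggregate_def)
next
  case (Suc t)
  have "mean (\<psi>_change t) = aggregate own \<psi> (x (Suc t)) - aggregate own \<psi> (x t)"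
    by (simp add: mean_def \<psi>_change_def aggregate_def sum_subtractf scaleR_diff_right)
  with Suc show ?case
    by (simp add: \<nu>_step mean_add mean_mix stochastic)
qed

lemma mean_y: "mean (y t) = mean (local_gradient2 t)"
proof (induction t)
  case 0
  have "y 0 = local_gradient2 0"
    using algorithm
    by (simp add: DGT_def local_gradient2_def stacked_gradient2_def vec_eq_iff[where 'b = 'a])
  then show ?case
    by simp
next
  case (Suc t)
  then show ?case
    by (simp add: y_step mean_add mean_diff mean_mix stochastic)
qed

text \<open>Stacking keeps only the entries in each agent's own block; nothing is lost because the
  local gradient vanishes elsewhere.\<close>

lemma block_stacked_gradient1:
  "block own i (stacked_gradient1 own f u v) = gradient1 (f i) (block own i u) (v $ i)"
proof -
  have "f i differentiable (at (block own i u, v $ i))"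
    using f_diff by (auto simp: differentiable_on_def)
  then have "(\<lambda>w. f i (w, v $ i)) differentiable (at (block own i u))"
    by (rule differentiable_chain_at[where f = "\<lambda>w. (w, v $ i)", unfolded o_def, rotated])
      (auto simp: differentiable_def intro!: exI derivative_eq_intros)
  then have "block own i (gradient1 (f i) (block own i u) (v $ i)) =
      gradient1 (f i) (block own i u) (v $ i)"
    unfolding gradient1_def by (rule block_gradient[OF f_block])
  moreover have "block own i (stacked_gradient1 own f u v) =
      block own i (gradient1 (f i) (block own i u) (v $ i))"
    by (simp add: vec_eq_iff stacked_gradient1_def)
  ultimately show ?thesis
    by simp
qed

lemma norm_vec_gradient_\<psi>_mult: "norm (vec_gradient (\<psi> i) (z t i) *v v) \<le> G * norm v"
proof -
  have "norm (vec_gradient (\<psi> i) (z t i) *v v) \<le>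
      onorm ((*v) (vec_gradient (\<psi> i) (z t i))) * norm v"
    by (rule onorm) simp
  also have "\<dots> \<le> G * norm v"
    using grad_\<psi>_bound[OF x_mem] by (rule mult_right_mono) simp
  finally show ?thesis .
qed

lemma norm_local_gradient2_nth: "norm (local_gradient2 t $ i) \<le> G"
  unfolding local_gradient2_def
  by (rule order_trans[OF Finite_Cartesian_Product.norm_nth_le grad2_bound[OF x_mem]])

lemma \<psi>_lipschitz:
  assumes "u \<in> X i" "v \<in> X i"
  shows "norm (\<psi> i u - \<psi> i v) \<le> G * norm (u - v)"
proof (rule lipschitz_of_vec_gradient_bound[OF \<psi>_diff X_convex assms])
  fix w assume "w \<in> X i"
  then obtain u where "u \<in> block_product own X" "block own i u = w"
    using block_product_extend[OF X_nonempty X_sub] by metis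
  then show "onorm ((*v) (vec_gradient (\<psi> i) w)) \<le> G"
    using grad_\<psi>_bound by blast
qed

lemma contraction_factor:
  "0 \<le> 1 - a ^ (CARD('a) * Q)" "1 - a ^ (CARD('a) * Q) < 1" "0 < CARD('a) * Q"
  using a_range Q_pos by (auto simp: power_le_one)

text \<open>Only the uniform gradient bound enters, not the movement of \<open>x\<close>, so there
  is no circularity when this later bounds that movement. The mean of \<open>y\<close> is a mean of
  gradients, hence at most \<open>G\<close>.\<close>

lemma y_bounded:
  obtains K where "\<And>t i. norm (y t $ i) \<le> K"
proof -
  \<comment> \<open>Each row is a difference of two gradients, at most \<open>2 * G\<close>, and the
    spread compares two rows.\<close>
  have "spread (local_gradient2 (Suc t) - local_gradient2 t) \<le> 4 * G" for t
  proof (rule spread_le)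
    fix i j
    have "norm (local_gradient2 (Suc t) $ k - local_gradient2 t $ k) \<le> 2 * G" for k
      using norm_triangle_ineq4[of "local_gradient2 (Suc t) $ k" "local_gradient2 t $ k"]
        norm_local_gradient2_nth[of "Suc t" k] norm_local_gradient2_nth[of t k] by simp
    from norm_triangle_le_diff[OF add_mono[OF this this]]
    show "norm ((local_gradient2 (Suc t) - local_gradient2 t) $ i -
        (local_gradient2 (Suc t) - local_gradient2 t) $ j) \<le> 4 * G"
      by simp
  qed
  then have "(\<Sum>s<CARD('a) * Q. spread (local_gradient2 (Suc (t + s)) - local_gradient2 (t + s)))
      \<le> real (CARD('a) * Q) * (4 * G)" for t
    using sum_bounded_above[of "{..<CARD('a) * Q}"
        "\<lambda>s. spread (local_gradient2 (Suc (t + s)) - local_gradient2 (t + s))" "4 * G"] by simp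
  then have "spread (y (t + CARD('a) * Q)) \<le>
      (1 - a ^ (CARD('a) * Q)) * spread (y t) + real (CARD('a) * Q) * (4 * G)" for t
    using spread_perturbed_contraction[OF y_step, of t] by (meson add_left_mono order_trans)
  then obtain K where K: "spread (y t) \<le> K" for t
    using delayed_contraction_bounded[OF contraction_factor(3,1,2), of "\<lambda>t. spread (y t)"]
      spread_nonneg by metis
  have "norm (y t $ i) \<le> K + G" for t i
  proof -
    have "norm (y t $ i) \<le> norm (y t $ i - mean (y t)) + norm (mean (y t))"
      using norm_triangle_ineq[of "y t $ i - mean (y t)" "mean (y t)"] by simp
    also have "\<dots> \<le> K + G"
      unfolding mean_y[of t, symmetric]
      by (intro add_mono order_trans[OF norm_diff_mean K])
        (simp add: mean_y norm_mean_le norm_local_gradient2_nth)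
    finally show ?thesis .
  qed
  then show thesis
    by (rule that)
qed

lemma direction_bounded:
  obtains D where "0 \<le> D" "\<And>t i. norm (direction t i) \<le> D"
proof -
  obtain K where K: "norm (y t $ i) \<le> K" for t i
    using y_bounded by blast
  have bound: "norm (direction t i) \<le> G + G * K" for t i
  proof -
    have "norm (gradient1 (f i) (z t i) (\<nu> t $ i)) \<le> norm (stacked_gradient1 own f (x t) (\<nu> t))"
      unfolding block_stacked_gradient1[symmetric] by (rule norm_block_le)
    also have "\<dots> \<le> G"
      by (rule grad1_bound[OF x_mem])
    finally have "norm (gradient1 (f i) (z t i) (\<nu> t $ i)) \<le> G" .
    moreover have "norm (vec_gradient (\<psi> i) (z t i) *v y t $ i) \<le> G * K"
      using norm_vec_gradient_\<psi>_mult mult_left_mono[OF K G_nonneg] by (rule order_trans)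
    ultimately show ?thesis
      unfolding direction_def by (rule norm_triangle_mono)
  qed
  show thesis
    using order_trans[OF norm_ge_zero bound] bound by (rule that)
qed

text \<open>\<open>z t i\<close> is its own projection, so nonexpansiveness bounds the move by the
  step before projection.\<close>

lemma norm_z_step:
  assumes "\<And>t i. norm (direction t i) \<le> D"
  shows "norm (z (Suc t) i - z t i) \<le> D * \<alpha> t"
proof -
  let ?w = "z t i - \<alpha> t *\<^sub>R direction t i"
  have "dist (closest_point (X i) ?w) (closest_point (X i) (z t i)) \<le> dist ?w (z t i)"
    using X_convex X_closed X_nonempty by (rule closest_point_lipschitz)
  then have "norm (z (Suc t) i - z t i) \<le> norm (?w - z t i)"
    by (simp add: z_step dist_norm closest_point_self z_mem)
  also have "\<dots> = \<alpha> t * norm (direction t i)"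
    using stepsize_pos[of t] by simp
  also have "\<dots> \<le> D * \<alpha> t"
    using stepsize_pos[of t] assms by (simp add: mult.commute)
  finally show ?thesis .
qed

lemma norm_\<psi>_change_nth:
  assumes "\<And>t i. norm (direction t i) \<le> D"
  shows "norm (\<psi>_change t $ i) \<le> G * D * \<alpha> t"
proof -
  have "norm (\<psi>_change t $ i) \<le> G * norm (z (Suc t) i - z t i)"
    by (simp add: \<psi>_change_def \<psi>_lipschitz z_mem)
  also have "\<dots> \<le> G * (D * \<alpha> t)"
    using norm_z_step[OF assms] G_nonneg by (rule mult_left_mono)
  finally show ?thesis
    by simp
qed

lemma sqrt_sums_spread_\<nu>: "sqrt_sums (\<lambda>t. spread (\<nu> t))"
proof -
  obtain D where D: "0 \<le> D" "\<And>t i. norm (direction t i) \<le> D"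
    using direction_bounded by blast
  have "spread (\<psi>_change t) \<le> 2 * G * D * \<alpha> t" for t
  proof (rule spread_le)
    fix i j
    show "norm (\<psi>_change t $ i - \<psi>_change t $ j) \<le> 2 * G * D * \<alpha> t"
      using norm_triangle_le_diff[OF add_mono[OF norm_\<psi>_change_nth[OF D(2), of t i]
            norm_\<psi>_change_nth[OF D(2), of t j]]] by (simp add: ac_simps)
  qed
  moreover have "sqrt_sums (\<lambda>t. 2 * G * D * \<alpha> t)"
    using D G_nonneg by (intro sqrt_sums_cmult sqrt_sums_stepsize stepsize) auto
  ultimately have "sqrt_sums (\<lambda>t. spread (\<psi>_change t))"
    by (rule sqrt_sums_mono[rotated])
  then show ?thesis
    by (rule sqrt_sums_delayed_contraction[OF contraction_factor(2) spread_nonneg spread_nonneg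
          spread_perturbed_contraction[OF \<nu>_step]])
qed

text \<open>The perturbation of \<open>y\<close> is Lipschitz in the changes of \<open>x\<close> and
  \<nu>, and the change of \<nu> includes its own disagreement; the estimate for the spread of \<nu>
  therefore comes first.\<close>

lemma sqrt_sums_spread_y: "sqrt_sums (\<lambda>t. spread (y t))"
proof -
  let ?N = "real CARD('a)"
  obtain D where D: "0 \<le> D" "\<And>t i. norm (direction t i) \<le> D"
    using direction_bounded by blast
  have x_change: "norm (x (Suc t) - x t) \<le> ?N * (D * \<alpha> t)" for t
  proof -
    have "norm (x (Suc t) - x t) \<le> (\<Sum>i\<in>UNIV. norm (z (Suc t) i - z t i))"
      using norm_le_sum_norm_block[of "x (Suc t) - x t" own] by (simp add: block_diff)
    also have "\<dots> \<le> ?N * (D * \<alpha> t)"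
      using norm_z_step[OF D(2)] by (intro sum_bounded_above)
    finally show ?thesis .
  qed
  have \<nu>_change: "norm (\<nu> (Suc t) - \<nu> t) \<le> ?N * (2 * spread (\<nu> t) + G * D * \<alpha> t)" for t
  proof -
    have "norm ((\<nu> (Suc t) - \<nu> t) $ i) \<le> 2 * spread (\<nu> t) + G * D * \<alpha> t" for i
    proof -
      let ?m = "mix (A t) (\<nu> t)"
      \<comment> \<open>Both deviations are taken from the common mean, which mixing
        preserves.\<close>
      have "(\<nu> (Suc t) - \<nu> t) $ i = (?m $ i - mean ?m) - (\<nu> t $ i - mean (\<nu> t)) + \<psi>_change t $ i"
        by (simp add: \<nu>_step mean_mix stochastic)
      also have "norm \<dots> \<le> (spread ?m + spread (\<nu> t)) + G * D * \<alpha> t"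
        by (intro norm_triangle_mono norm_triangle_le_diff add_mono norm_diff_mean
            norm_\<psi>_change_nth D)
      finally show ?thesis
        using spread_mix[of t "\<nu> t"] by simp
    qed
    then have "(\<Sum>i\<in>UNIV. norm ((\<nu> (Suc t) - \<nu> t) $ i)) \<le> ?N * (2 * spread (\<nu> t) + G * D * \<alpha> t)"
      by (intro sum_bounded_above)
    with norm_le_sum_norm_nth show ?thesis
      by (rule order_trans)
  qed
  have "spread (local_gradient2 (Suc t) - local_gradient2 t) \<le>
      2 * L * ?N * (D + G * D) * \<alpha> t + 4 * L * ?N * spread (\<nu> t)" for t
  proof -
    have "spread (local_gradient2 (Suc t) - local_gradient2 t) \<le>
        2 * norm (local_gradient2 (Suc t) - local_gradient2 t)"
      by (rule spread_le_norm)
    also have "norm (local_gradient2 (Suc t) - local_gradient2 t) \<le>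
        L * (norm (x (Suc t) - x t) + norm (\<nu> (Suc t) - \<nu> t))"
      unfolding local_gradient2_def by (rule grad2_lipschitz[OF x_mem x_mem])
    also have "\<dots> \<le> L * (?N * (D * \<alpha> t) + ?N * (2 * spread (\<nu> t) + G * D * \<alpha> t))"
      using add_mono[OF x_change \<nu>_change] L_nonneg by (rule mult_left_mono)
    finally show ?thesis
      by (simp add: algebra_simps)
  qed
  moreover have "sqrt_sums (\<lambda>t. 2 * L * ?N * (D + G * D) * \<alpha> t + 4 * L * ?N * spread (\<nu> t))"
    using L_nonneg G_nonneg D
    by (intro sqrt_sums_add sqrt_sums_cmult sqrt_sums_spread_\<nu> sqrt_sums_stepsize stepsize) auto
  ultimately have "sqrt_sums (\<lambda>t. spread (local_gradient2 (Suc t) - local_gradient2 t))"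
    by (rule sqrt_sums_mono[rotated])
  then show ?thesis
    by (rule sqrt_sums_delayed_contraction[OF contraction_factor(2) spread_nonneg spread_nonneg
          spread_perturbed_contraction[OF y_step]])
qed

text \<open>Disagreement in \<nu> enters once through the first gradient and once through the
  second, there multiplied by the bound \<open>G\<close> for the gradient of
  \<open>\<psi> i\<close>; the last term is the disagreement in \<open>y\<close>.\<close>

definition gradient_error :: "nat \<Rightarrow> real" where
  "gradient_error t = (1 + G) * L * real CARD('a) * spread (\<nu> t) + G * spread (y t)"

text \<open>The comparison point is the consensus vector \<open>?c\<close>, whose rows equal the
  exact aggregate by \<open>mean_\<nu>\<close>.\<close>

lemma norm_direction_error:
  "norm (direction t i - loss_gradient own \<psi> f (x t) i) \<le> gradient_error t"
proof -
  let ?c = "\<chi> j. mean (\<nu> t)" and ?N = "real CARD('a)"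
  let ?h = "stacked_gradient2 own f (x t) ?c"
  let ?g = "\<lambda>v. stacked_gradient1 own f (x t) v"
  have consensus: "L * (norm (x t - x t) + norm (\<nu> t - ?c)) \<le> L * ?N * spread (\<nu> t)"
    using mult_left_mono[OF norm_diff_const_mean L_nonneg] by (simp add: mult.assoc)
  have "norm (block own i (?g (\<nu> t) - ?g ?c)) \<le> norm (?g (\<nu> t) - ?g ?c)"
    by (rule norm_block_le)
  also have "\<dots> \<le> L * ?N * spread (\<nu> t)"
    using grad1_lipschitz[OF x_mem x_mem] consensus by (rule order_trans)
  finally have first: "norm (block own i (?g (\<nu> t) - ?g ?c)) \<le> L * ?N * spread (\<nu> t)" .
  have "norm (local_gradient2 t - ?h) \<le> L * ?N * spread (\<nu> t)"
    unfolding local_gradient2_def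
    using grad2_lipschitz[OF x_mem x_mem] consensus by (rule order_trans)
  then have "norm (mean (local_gradient2 t - ?h)) \<le> L * ?N * spread (\<nu> t)"
    by (intro norm_mean_le order_trans[OF Finite_Cartesian_Product.norm_nth_le])
  \<comment> \<open>Since \<open>y\<close> has the mean of the local gradients, this sum is
    \<open>y t $ i - mean ?h\<close>: a consensus error plus the error of evaluating gradients at
    \<nu>.\<close>
  then have "norm ((y t $ i - mean (y t)) + mean (local_gradient2 t - ?h)) \<le>
      spread (y t) + L * ?N * spread (\<nu> t)"
    by (intro norm_triangle_mono norm_diff_mean)
  then have "norm (y t $ i - mean ?h) \<le> spread (y t) + L * ?N * spread (\<nu> t)"
    by (simp add: mean_y mean_diff)
  from mult_left_mono[OF this G_nonneg]
  have second: "norm (vec_gradient (\<psi> i) (z t i) *v (y t $ i - mean ?h)) \<le>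
      G * (spread (y t) + L * ?N * spread (\<nu> t))"
    by (rule order_trans[OF norm_vec_gradient_\<psi>_mult])
  have "direction t i - loss_gradient own \<psi> f (x t) i =
      block own i (?g (\<nu> t) - ?g ?c) + vec_gradient (\<psi> i) (z t i) *v (y t $ i - mean ?h)"
    by (simp add: direction_def loss_gradient_def block_diff block_stacked_gradient1 mean_\<nu>
        matrix_vector_mult_diff_distrib)
  also have "norm \<dots> \<le> L * ?N * spread (\<nu> t) + G * (spread (y t) + L * ?N * spread (\<nu> t))"
    using first second by (rule norm_triangle_mono)
  finally show ?thesis
    by (simp add: gradient_error_def algebra_simps)
qed

text \<open>Each agent makes its own projected step; summing over the orthogonal blocks assembles
  the squared distances, and the tangent inequality brings in the loss. The factor \<open>N\<close>
  counts the agents' equal error terms.\<close>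

lemma loss_gap_le:
  assumes u: "u \<in> block_product own X" and D: "\<And>t i. norm (direction t i) \<le> D"
  shows "2 * \<alpha> t * (total_loss own \<psi> f (x t) - total_loss own \<psi> f u) \<le>
    (norm (x t - u))\<^sup>2 - (norm (x (Suc t) - u))\<^sup>2 +
    2 * \<alpha> t * real CARD('a) * (D\<^sup>2 / 2 * \<alpha> t + 2 * B * gradient_error t)"
proof -
  let ?N = "real CARD('a)"
  let ?l = "loss_gradient own \<psi> f (x t)" and ?w = "\<lambda>i. block own i u"
  have agent: "2 * \<alpha> t * ((z t i - ?w i) \<bullet> ?l i) \<le>
      (norm (z t i - ?w i))\<^sup>2 - (norm (z (Suc t) i - ?w i))\<^sup>2 +
      2 * \<alpha> t * (D\<^sup>2 / 2 * \<alpha> t + 2 * B * gradient_error t)" for i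
  proof -
    have w: "?w i \<in> X i"
      using u by (simp add: block_product_def)
    have diam: "norm (z t i - ?w i) \<le> B + B"
      by (intro norm_triangle_le_diff add_mono X_bound[OF w] X_bound[OF z_mem])
    have "norm (z t i - ?w i) * norm (direction t i - ?l i) \<le> (B + B) * gradient_error t"
      using diam norm_direction_error order_trans[OF norm_ge_zero diam] norm_ge_zero
      by (rule mult_mono)
    moreover have "(z t i - ?w i) \<bullet> (?l i - direction t i) \<le>
        norm (z t i - ?w i) * norm (direction t i - ?l i)"
      using norm_cauchy_schwarz[of "z t i - ?w i" "?l i - direction t i"]
      by (simp add: norm_minus_commute)
    ultimately have "(z t i - ?w i) \<bullet> ?l i \<le>
        direction t i \<bullet> (z t i - ?w i) + 2 * B * gradient_error t"
      by (simp add: inner_diff_right[of _ "?l i"] inner_commute[of "direction t i"])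
    then have "2 * \<alpha> t * ((z t i - ?w i) \<bullet> ?l i) \<le>
        2 * \<alpha> t * (direction t i \<bullet> (z t i - ?w i) + 2 * B * gradient_error t)"
      using stepsize_pos[of t] by (intro mult_left_mono) auto
    moreover have "(norm (z (Suc t) i - ?w i))\<^sup>2 \<le> (norm (z t i - ?w i))\<^sup>2 -
        2 * \<alpha> t * (direction t i \<bullet> (z t i - ?w i)) + (\<alpha> t)\<^sup>2 * (norm (direction t i))\<^sup>2"
      unfolding z_step by (rule projected_step[OF X_convex X_closed w])
    moreover have "(\<alpha> t)\<^sup>2 * (norm (direction t i))\<^sup>2 \<le> (\<alpha> t)\<^sup>2 * D\<^sup>2"
      using D by (intro mult_left_mono power_mono) auto
    ultimately show ?thesis
      by (simp add: algebra_simps power2_eq_square)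
  qed
  have norm_blocks: "(\<Sum>i\<in>UNIV. (norm (block own i v - ?w i))\<^sup>2) = (norm (v - u))\<^sup>2" for v
    by (simp add: power2_norm_eq_inner sum_inner_block flip: block_diff)
  have "total_loss own \<psi> f (x t) +
      (\<Sum>i\<in>UNIV. block own i (u - x t) \<bullet> ?l i) \<le> total_loss own \<psi> f u"
    by (rule convex_on_above_tangent[OF f_convex has_derivative_total_loss[OF \<psi>_diff f_diff]])
  then have "total_loss own \<psi> f (x t) - total_loss own \<psi> f u \<le> (\<Sum>i\<in>UNIV. (z t i - ?w i) \<bullet> ?l i)"
    by (simp add: block_diff inner_diff_left sum_subtractf)
  then have "2 * \<alpha> t * (total_loss own \<psi> f (x t) - total_loss own \<psi> f u) \<le>
      2 * \<alpha> t * (\<Sum>i\<in>UNIV. (z t i - ?w i) \<bullet> ?l i)"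
    using stepsize_pos[of t] by (intro mult_left_mono) auto
  also have "\<dots> = (\<Sum>i\<in>UNIV. 2 * \<alpha> t * ((z t i - ?w i) \<bullet> ?l i))"
    by (rule sum_distrib_left)
  also have "\<dots> \<le> (\<Sum>i\<in>UNIV. (norm (z t i - ?w i))\<^sup>2 - (norm (z (Suc t) i - ?w i))\<^sup>2 +
      2 * \<alpha> t * (D\<^sup>2 / 2 * \<alpha> t + 2 * B * gradient_error t))"
    by (intro sum_mono agent)
  also have "\<dots> = (norm (x t - u))\<^sup>2 - (norm (x (Suc t) - u))\<^sup>2 +
      2 * \<alpha> t * ?N * (D\<^sup>2 / 2 * \<alpha> t + 2 * B * gradient_error t)"
    by (simp only: sum.distrib sum_subtractf norm_blocks) simp
  finally show ?thesis .
qed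

text \<open>Dividing the one-step inequality by the stepsize puts weights \<open>sqrt t\<close> on
  the distance decrements, which summation by parts controls through a uniform distance
  bound.\<close>

theorem average_loss_gap:
  assumes u: "u \<in> block_product own X"
  obtains C where "\<And>T. T \<ge> 1 \<Longrightarrow>
    total_loss own \<psi> f ((1 / real T) *\<^sub>R (\<Sum>t=1..T. x t)) - total_loss own \<psi> f u
      \<le> C * (1 / sqrt (real T))"
proof -
  let ?F = "total_loss own \<psi> f" and ?N = "real CARD('a)"
  obtain D where D: "0 \<le> D" "\<And>t i. norm (direction t i) \<le> D"
    using direction_bounded by blast
  define e where "e t = ?N * (D\<^sup>2 / 2 * \<alpha> t + 2 * B * gradient_error t)" for t
  have B: "0 \<le> B"
    using X_bound[OF z_mem] norm_ge_zero order_trans by blast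
  have e_nonneg: "0 \<le> e t" for t
    using B L_nonneg G_nonneg stepsize_pos[of t] spread_nonneg[of "\<nu> t"] spread_nonneg[of "y t"]
    by (simp add: e_def gradient_error_def)
  have "sqrt_sums e"
    unfolding e_def gradient_error_def using B L_nonneg G_nonneg
    by (intro sqrt_sums_add sqrt_sums_cmult sqrt_sums_spread_\<nu> sqrt_sums_spread_y
        sqrt_sums_stepsize stepsize) auto
  then obtain C where C: "(\<Sum>t<T. e t) \<le> C * sqrt (real T)" for T
    by (auto simp: sqrt_sums_def)
  \<comment> \<open>Each of the \<open>N\<close> blocks has diameter at most
    \<open>2 * B\<close>.\<close>
  define K where "K = (2 * ?N * B)\<^sup>2"
  define R where "R t = (norm (x t - u))\<^sup>2" for t
  have R: "R t \<le> K" for t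
  proof -
    have "norm (z t i - block own i u) \<le> B + B" for i
      using u by (intro norm_triangle_le_diff add_mono X_bound[OF z_mem] X_bound[of _ i])
        (auto simp: block_product_def)
    then have "(\<Sum>i\<in>UNIV. norm (block own i (x t - u))) \<le> ?N * (B + B)"
      unfolding block_diff by (intro sum_bounded_above)
    then have "norm (x t - u) \<le> 2 * ?N * B"
      using norm_le_sum_norm_block[of "x t - u" own] by simp
    then show ?thesis
      unfolding R_def K_def by (rule power_mono) simp
  qed
  \<comment> \<open>Time 0 is left out: its stepsize is set to 1 separately, and the average starts
    at \<open>t = 1\<close>.\<close>
  have gap: "?F (x t) - ?F u \<le> 1 / 2 * (sqrt (real t) * (R t - R (Suc t))) + e t" if "t \<ge> 1" for t
  proof -
    have "2 * \<alpha> t * (?F (x t) - ?F u) \<le> R t - R (Suc t) + 2 * \<alpha> t * e t"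
      using loss_gap_le[OF u D(2), of t] by (simp add: R_def e_def mult.assoc)
    moreover have "\<alpha> t = 1 / sqrt (real t)" "0 < sqrt (real t)"
      using that by (auto simp: stepsize)
    moreover have "d \<le> 1 / 2 * (s * r) + e" if "2 * (1 / s) * d \<le> r + 2 * (1 / s) * e" "0 < s"
      for d e r s :: real
      using that by (simp add: field_simps)
    ultimately show ?thesis
      by metis
  qed
  have "?F ((1 / real T) *\<^sub>R (\<Sum>t=1..T. x t)) - ?F u \<le> (K / 2 + 2 * \<bar>C\<bar>) * (1 / sqrt (real T))"
    if T: "T \<ge> 1" for T
  proof -
    \<comment> \<open>Jensen's inequality with equal weights.\<close>
    have "?F (\<Sum>t=1..T. (1 / real T) *\<^sub>R x t) \<le> (\<Sum>t=1..T. (1 / real T) * ?F (x t))"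
      using T by (intro convex_on_sum[OF _ _ f_convex]) auto
    then have "real T * (?F ((1 / real T) *\<^sub>R (\<Sum>t=1..T. x t)) - ?F u) \<le> (\<Sum>t=1..T. ?F (x t) - ?F u)"
      using T by (simp add: scaleR_sum_right sum_subtractf field_simps flip: sum_divide_distrib)
    also have "\<dots> \<le> (\<Sum>t=1..T. 1 / 2 * (sqrt (real t) * (R t - R (Suc t))) + e t)"
      by (intro sum_mono gap) simp
    also have "\<dots> = 1 / 2 * (\<Sum>t=1..T. sqrt (real t) * (R t - R (Suc t))) + (\<Sum>t=1..T. e t)"
      by (simp only: sum.distrib sum_distrib_left)
    also have "(\<Sum>t=1..T. sqrt (real t) * (R t - R (Suc t))) \<le> sqrt (real T) * (K - R (Suc T))"
      using R by (rule sum_sqrt_telescope_le)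
    also have "\<dots> \<le> sqrt (real T) * K"
      by (intro mult_left_mono) (auto simp: R_def)
    also have "(\<Sum>t=1..T. e t) \<le> (\<Sum>t<Suc T. e t)"
      using e_nonneg by (intro sum_mono2) auto
    also have "\<dots> \<le> \<bar>C\<bar> * sqrt (real (Suc T))"
      using C[of "Suc T"] by (rule order_trans) (intro mult_right_mono, auto)
    \<comment> \<open>For \<open>T\<close> at least 1, \<open>T + 1\<close> is at most
      \<open>4 * T\<close>; the perfect square yields the factor 2 in the final constant.\<close>
    also have "\<dots> \<le> \<bar>C\<bar> * sqrt (4 * real T)"
      using T by (intro mult_left_mono) auto
    finally have "real T * (?F ((1 / real T) *\<^sub>R (\<Sum>t=1..T. x t)) - ?F u) \<le>
        (K / 2 + 2 * \<bar>C\<bar>) * sqrt (real T)"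
      by (simp add: real_sqrt_mult algebra_simps)
    also have "\<dots> = (K / 2 + 2 * \<bar>C\<bar>) * (real T * (1 / sqrt (real T)))"
      by (simp add: real_div_sqrt)
    also have "\<dots> = real T * ((K / 2 + 2 * \<bar>C\<bar>) * (1 / sqrt (real T)))"
      by (rule mult.left_commute)
    finally show ?thesis
      by (rule mult_left_le_imp_le) (use T in simp)
  qed
  then show thesis
    by (rule that)
qed

end

theorem corollary1:
  fixes own :: "'n::finite \<Rightarrow> 'a::finite"
    and X :: "'a \<Rightarrow> (real ^ 'n) set"
    and \<psi> :: "'a \<Rightarrow> real ^ 'n \<Rightarrow> real ^ 'd::finite"
    and f :: "'a \<Rightarrow> (real ^ 'n) \<times> (real ^ 'd) \<Rightarrow> real"
    and E :: "nat \<Rightarrow> ('a \<times> 'a) set"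
    and A :: "nat \<Rightarrow> real ^ 'a ^ 'a"
    and \<alpha> :: "nat \<Rightarrow> real"
    and x :: "nat \<Rightarrow> real ^ 'n"
    and \<nu> y :: "nat \<Rightarrow> real ^ 'd ^ 'a"
    and B L1 G L2 a :: real and Q :: nat
    and xstar :: "real ^ 'n"
  assumes X_sub: "\<And>i. X i \<subseteq> block_space own i"
    and \<psi>_block: "\<And>i. depends_on_block own i (\<psi> i)"
    and f_block: "\<And>i v. depends_on_block own i (\<lambda>u. f i (u, v))"
    and \<psi>_diff: "\<And>i. \<psi> i differentiable_on UNIV"
    and f_diff: "\<And>i. f i differentiable_on UNIV"
    and weights: "\<And>t. weight_matrix (E t) (A t)"
    and X_convex_compact: "\<And>i. X i \<noteq> {} \<and> convex (X i) \<and> compact (X i)"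
    and B_pos: "B > 0"
    and X_bound: "\<And>i u. u \<in> X i \<Longrightarrow> norm u \<le> B"
    and f_convex: "convex_on UNIV (total_loss own \<psi> f)"
    and grad1_lipschitz: "\<And>u u' v v'. u \<in> block_product own X \<Longrightarrow> u' \<in> block_product own X \<Longrightarrow>
      norm (stacked_gradient1 own f u v - stacked_gradient1 own f u' v')
        \<le> L1 * (norm (u - u') + norm (v - v'))"
    and grad2_lipschitz: "\<And>u u' v v'. u \<in> block_product own X \<Longrightarrow> u' \<in> block_product own X \<Longrightarrow>
      norm (stacked_gradient2 own f u v - stacked_gradient2 own f u' v')
        \<le> L1 * (norm (u - u') + norm (v - v'))"
    and G_pos: "G > 0"
    and grad1_bound: "\<And>u v. u \<in> block_product own X \<Longrightarrow> norm (stacked_gradient1 own f u v) \<le> G"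
    and grad2_bound: "\<And>u v. u \<in> block_product own X \<Longrightarrow> norm (stacked_gradient2 own f u v) \<le> G"
    and grad_\<psi>_bound: "\<And>u i. u \<in> block_product own X \<Longrightarrow>
      onorm ((*v) (vec_gradient (\<psi> i) (block own i u))) \<le> G"
    and grad_\<psi>_lipschitz: "\<And>i u u'. u \<in> X i \<Longrightarrow> u' \<in> X i \<Longrightarrow>
      onorm ((*v) (vec_gradient (\<psi> i) u - vec_gradient (\<psi> i) u')) \<le> L2 * norm (u - u')"
    and Q_pos: "Q > 0"
    and connected: "\<And>k. strongly_connected
      (with_proj \<lparr>pverts = UNIV, parcs = (\<Union>l\<in>{0..Q - 1}. E (k + l))\<rparr>)"
    and stochastic: "\<And>t. doubly_stochastic (A t)"
    and a_range: "0 < a" "a < 1"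
    and a_lower: "\<And>t i j. A t $ i $ j > 0 \<Longrightarrow> A t $ i $ j \<ge> a"
    and a_diag: "\<And>t i. A t $ i $ i \<ge> a"
    and stepsize: "\<And>t. \<alpha> t = (if t = 0 then 1 else 1 / sqrt (real t))"
    and algorithm: "DGT own X \<psi> f A \<alpha> x \<nu> y"
    and minimizer: "is_arg_min (total_loss own \<psi> f) (\<lambda>u. u \<in> block_product own X) xstar"
  shows "\<exists>C. \<forall>T\<ge>1.
    \<bar>total_loss own \<psi> f ((1 / real T) *\<^sub>R (\<Sum>t=1..T. x t)) - total_loss own \<psi> f xstar\<bar>
      \<le> C * (1 / sqrt (real T))"
proof -
  \<comment> \<open>\<open>L1\<close> comes without a sign condition, so its absolute value serves
    as Lipschitz constant.\<close>
  interpret gradient_tracking E A a Q own X \<psi> f \<alpha> x \<nu> y B "\<bar>L1\<bar>" G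
  proof unfold_locales
    show "norm (stacked_gradient1 own f u v - stacked_gradient1 own f u' v')
        \<le> \<bar>L1\<bar> * (norm (u - u') + norm (v - v'))"
      if "u \<in> block_product own X" "u' \<in> block_product own X" for u u' v v'
      using grad1_lipschitz[OF that] by (rule order_trans) (intro mult_right_mono, auto)
    show "norm (stacked_gradient2 own f u v - stacked_gradient2 own f u' v')
        \<le> \<bar>L1\<bar> * (norm (u - u') + norm (v - v'))"
      if "u \<in> block_product own X" "u' \<in> block_product own X" for u u' v v'
      using grad2_lipschitz[OF that] by (rule order_trans) (intro mult_right_mono, auto)
    show "X i \<noteq> {}" "convex (X i)" "closed (X i)" for i
      using X_convex_compact compact_imp_closed by auto
    show "0 \<le> \<bar>L1\<bar>" "0 \<le> G"
      using G_pos by auto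
  qed fact+
  let ?avg = "\<lambda>T. (1 / real T) *\<^sub>R (\<Sum>t=1..T. x t)"
  have xstar: "xstar \<in> block_product own X"
    and min: "u \<in> block_product own X \<Longrightarrow> total_loss own \<psi> f xstar \<le> total_loss own \<psi> f u" for u
    using minimizer by (auto simp: is_arg_min_def not_less)
  \<comment> \<open>Feasibility of the average makes the gap nonnegative by minimality, which turns
    the upper bound into one for the absolute value.\<close>
  have avg: "?avg T \<in> block_product own X" if "T \<ge> 1" for T
  proof -
    have "convex (block_product own X)"
      using X_convex_compact by (intro convex_block_product) auto
    then have "(\<Sum>t=1..T. (1 / real T) *\<^sub>R x t) \<in> block_product own X"
      using that x_mem by (intro convex_sum) auto
    then show ?thesis
      by (simp add: scaleR_sum_right)
  qed
  obtain C where "total_loss own \<psi> f (?avg T) - total_loss own \<psi> f xstar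
      \<le> C * (1 / sqrt (real T))" if "T \<ge> 1" for T
    using average_loss_gap[OF xstar] by metis
  then have "\<forall>T\<ge>1. \<bar>total_loss own \<psi> f (?avg T) - total_loss own \<psi> f xstar\<bar>
      \<le> C * (1 / sqrt (real T))"
    using min[OF avg] by (simp add: abs_of_nonneg)
  then show ?thesis
    by blast
qed

end
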